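(* Let $P\subseteq\mathbb{R}^d$ be a rational $d$-polytope with codenominator $r$, and let $m\in\mathbb{Z}_{>0}$ be such that $\frac mrP$ is a lattice polytope. (i) The rational Ehrhart series of the open polytope $P^\circ$ has the rational expression $$\operatorname{Ehr}_{\mathbb{Q}}(P^\circ;t)=\frac{\operatorname{h}^*_{\mathbb{Q}}(P^\circ;t;m)}{\left(1-t^{\frac mr}\right)^{d+1}},$$ where $\operatorname{h}^*_{\mathbb{Q}}(P^\circ;t;m)$ is a polynomial in $\mathbb{Z}[t^{\frac1r}]$. (ii) The rational Ehrhart series fulfills the reciprocity relation (as rational functions in $t^{1/r}$) $$\operatorname{Ehr}_{\mathbb{Q}}(P^\circ;t)=(-1)^{d+1}\operatorname{Ehr}_{\mathbb{Q}}\left(P;\tfrac1t\right).$$ (iii) The $\operatorname{h}^*_{\mathbb{Q}}$-polynomials of $P$ and its interior $P^\circ$ are related by $$\operatorname{h}^*_{\mathbb{Q}}(P^\circ;t;m)=\left(t^{\frac mr}\right)^{d+1}\operatorname{h}^*_{\mathbb{Q}}\left(P;\tfrac1t;m\right).$$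
   Context: A rational (resp. lattice) polytope is the convex hull of finitely many points of $\mathbb{Q}^d$ (resp. $\mathbb{Z}^d$); a $d$-polytope is a $d$-dimensional polytope in $\mathbb{R}^d$, $d\ge1$; $P^\circ$ is the interior. Codenominator: write a rational $d$-polytope $P$ by its irredundant halfspace description $P=\{\mathbf{x}\in\mathbb{R}^d:\mathbf{A}\mathbf{x}\le\mathbf{b}\}$ with $\mathbf{A}\in\mathbb{Z}^{n\times d}$, $\mathbf{b}\in\mathbb{Z}^n$, such that for every $i$ the greatest common divisor of $b_i$ and the entries of the $i$th row of $\mathbf{A}$ is $1$; the codenominator of $P$ is the (positive) least common multiple $r$ of the nonzero entries of $\mathbf{b}$. Put $\operatorname{ehr}_{\mathbb{Q}}(P;\lambda)=|\lambda P\cap\mathbb{Z}^d|$ and $\operatorname{ehr}_{\mathbb{Q}}(P^\circ;\lambda)=|\lambda P^\circ\cap\mathbb{Z}^d|$ for rational $\lambda>0$; $\operatorname{Ehr}_{\mathbb{Q}}(P;t)=1+\sum_{\lambda\in\frac1r\mathbb{Z}_{>0}}\operatorname{ehr}_{\mathbb{Q}}(P;\lambda)t^\lambda$ and $\operatorname{Ehr}_{\mathbb{Q}}(P^\circ;t)=\sum_{\lambda\in\frac1r\mathbb{Z}_{>0}}\operatorname{ehr}_{\mathbb{Q}}(P^\circ;\lambda)t^\lambda$. For $m\in\mathbb{Z}_{>0}$ with $\frac mrP$ a lattice polytope, $\operatorname{h}^*_{\mathbb{Q}}(P;t;m):=(1-t^{m/r})^{d+1}\operatorname{Ehr}_{\mathbb{Q}}(P;t)$,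 which is a polynomial in $\mathbb{Z}[t^{1/r}]$; thus $\operatorname{Ehr}_{\mathbb{Q}}(P;t)$ is a rational function in $t^{1/r}$. *)

theory Defs
  imports
    "HOL-Analysis.Analysis"
    "HOL-Computational_Algebra.Computational_Algebra"
begin

definition rational_polytope :: "(real^'n) set \<Rightarrow> bool" where
  "rational_polytope P \<longleftrightarrow>
     (\<exists>V. finite V \<and> (\<forall>v\<in>V. \<forall>i. v $ i \<in> \<rat>) \<and> P = convex hull V)"

definition lattice_polytope :: "(real^'n) set \<Rightarrow> bool" where
  "lattice_polytope P \<longleftrightarrow>
     (\<exists>V. finite V \<and> (\<forall>v\<in>V. \<forall>i. v $ i \<in> \<int>) \<and> P = convex hull V)"

definition full_dimensional :: "(real^'n) set \<Rightarrow> bool" where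
  "full_dimensional P \<longleftrightarrow> aff_dim P = int CARD('n)"

text \<open>A system of integer inequalities is given by the set of its rows \<open>(a, b)\<close>,
  each standing for \<open>a \<bullet> x \<le> b\<close>; repeated rows would be redundant anyway.\<close>

definition solution_set :: "((int^'n) \<times> int) set \<Rightarrow> (real^'n) set" where
  "solution_set H = {x. \<forall>(a, b)\<in>H. (\<Sum>i\<in>UNIV. real_of_int (a $ i) * x $ i) \<le> real_of_int b}"

definition irredundant_description :: "(real^'n) set \<Rightarrow> ((int^'n) \<times> int) set \<Rightarrow> bool" where
  "irredundant_description P H \<longleftrightarrow>
     finite H \<and> P = solution_set H \<and> (\<forall>h\<in>H. solution_set (H - {h}) \<noteq> P) \<and>
     (\<forall>(a, b)\<in>H. Gcd (insert b (range (\<lambda>i. a $ i))) = 1)"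

definition has_codenominator :: "(real^'n) set \<Rightarrow> nat \<Rightarrow> bool" where
  "has_codenominator P r \<longleftrightarrow>
     (\<exists>H. irredundant_description P H \<and> int r = Lcm (snd ` H - {0}))"

definition ehr_Q :: "(real^'n) set \<Rightarrow> rat \<Rightarrow> nat" where
  "ehr_Q S l = card ((\<lambda>x. of_rat l *\<^sub>R x) ` S \<inter> {x. \<forall>i. x $ i \<in> \<int>})"

text \<open>All series are written in the variable \<open>t\<^sup>1\<^sup>/\<^sup>r\<close>: the coefficient of index \<open>k\<close> is
  the one of \<open>t\<^sup>k\<^sup>/\<^sup>r\<close>.\<close>

definition Ehr_Q :: "nat \<Rightarrow> (real^'n) set \<Rightarrow> int fps" where
  "Ehr_Q r P = Abs_fps (\<lambda>k. if k = 0 then 1 else int (ehr_Q P (of_nat k / of_nat r)))"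

definition Ehr_Q_interior :: "nat \<Rightarrow> (real^'n) set \<Rightarrow> int fps" where
  "Ehr_Q_interior r P =
     Abs_fps (\<lambda>k. if k = 0 then 0 else int (ehr_Q (interior P) (of_nat k / of_nat r)))"

definition hstar_Q :: "nat \<Rightarrow> nat \<Rightarrow> (real^'n) set \<Rightarrow> int fps" where
  "hstar_Q r m P = (1 - fps_X ^ m) ^ (CARD('n) + 1) * Ehr_Q r P"

text \<open>The field of rational functions in \<open>t\<^sup>1\<^sup>/\<^sup>r\<close> is the fraction field of
  \<open>\<int>[t\<^sup>1\<^sup>/\<^sup>r]\<close>, that is, \<open>\<rat>(t\<^sup>1\<^sup>/\<^sup>r)\<close>; \<open>root_t\<close> is its element \<open>t\<^sup>1\<^sup>/\<^sup>r\<close>.\<close>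

type_synonym ratfun = "int poly fract"

definition root_t :: ratfun where
  "root_t = to_fract [:0, 1:]"

definition expansion :: "int fps \<Rightarrow> ratfun \<Rightarrow> bool" where
  "expansion f F \<longleftrightarrow>
     (\<exists>p q. q \<noteq> 0 \<and> F = to_fract p / to_fract q \<and> f * fps_of_poly q = fps_of_poly p)"

definition eval_poly :: "int poly \<Rightarrow> ratfun \<Rightarrow> ratfun" where
  "eval_poly p x = poly (map_poly of_int p) x"

text \<open>Substitution of \<open>x\<close> for \<open>t\<^sup>1\<^sup>/\<^sup>r\<close>, meaningful if the denominator does not vanish at
  \<open>x\<close>; for \<open>x = 1 / root_t\<close>, i.e. for \<open>t \<mapsto> 1/t\<close>, this is always so (see below).\<close>

definition subst_ratfun :: "ratfun \<Rightarrow> ratfun \<Rightarrow> ratfun" where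
  "subst_ratfun F x = (case quot_of_fract F of (p, q) \<Rightarrow> eval_poly p x / eval_poly q x)"

lemma expansion_unique:
  assumes "expansion f F" "expansion f G"
  shows "F = G"
proof -
  obtain p q where 1: "q \<noteq> 0" "F = to_fract p / to_fract q" "f * fps_of_poly q = fps_of_poly p"
    using assms(1) unfolding expansion_def by blast
  obtain p' q' where 2: "q' \<noteq> 0" "G = to_fract p' / to_fract q'"
      "f * fps_of_poly q' = fps_of_poly p'"
    using assms(2) unfolding expansion_def by blast
  have "fps_of_poly (p * q') = fps_of_poly (p' * q)"
    by (simp add: fps_of_poly_mult flip: 1(3) 2(3))
  hence "p * q' = p' * q"
    by (simp add: fps_of_poly_eq_iff)
  hence "to_fract p * to_fract q' = to_fract p' * to_fract q"
    by (metis to_fract_mult)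
  thus ?thesis
    using 1 2 by (simp add: frac_eq_eq)
qed

lemma eval_poly_mult: "eval_poly (p * q) x = eval_poly p x * eval_poly q x"
proof -
  have "map_poly of_int (p * q) = map_poly of_int p * (map_poly of_int q :: ratfun poly)"
    by (rule poly_eqI) (simp add: coeff_mult coeff_map_poly)
  thus ?thesis
    by (simp add: eval_poly_def)
qed

lemma eval_poly_root_t: "eval_poly p root_t = to_fract p"
proof -
  have of_int: "(of_int c :: ratfun) = to_fract [:c:]" for c
  proof -
    have "(of_nat n :: ratfun) = to_fract (of_nat n)" for n
      by (induction n) auto
    hence "(of_int c :: ratfun) = to_fract (of_int c)"
      by (cases c rule: int_cases2) auto
    thus ?thesis
      by (simp add: of_int_poly)
  qed
  show ?thesis
  proof (induction p)
    case 0
    show ?case by (simp add: eval_poly_def)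
  next
    case (pCons a p)
    have "eval_poly (pCons a p) root_t = of_int a + root_t * eval_poly p root_t"
      using pCons(1) by (simp add: eval_poly_def map_poly_pCons)
    also have "\<dots> = to_fract ([:a:] + [:0, 1:] * p)"
      by (simp only: pCons(2) of_int to_fract_add to_fract_mult flip: root_t_def)
    also have "[:a:] + [:0, 1:] * p = pCons a p"
      by simp
    finally show ?case .
  qed
qed

lemma eval_poly_inverse_root_t_nonzero:
  assumes "q \<noteq> 0"
  shows "eval_poly q (1 / root_t) \<noteq> 0"
proof -
  have nz: "root_t \<noteq> 0"
    by (simp add: root_t_def)
  have "reflect_poly (map_poly of_int q) = (map_poly of_int (reflect_poly q) :: ratfun poly)"
    by (rule poly_eqI)
       (simp add: coeff_reflect_poly coeff_map_poly map_poly_degree_eq degree_map_poly)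
  hence "to_fract (reflect_poly q) = poly (reflect_poly (map_poly of_int q)) root_t"
    using eval_poly_root_t[of "reflect_poly q"] by (simp add: eval_poly_def)
  also have "\<dots> = root_t ^ degree (map_poly of_int q :: ratfun poly) * eval_poly q (1 / root_t)"
    using nz by (simp add: poly_reflect_poly_nz eval_poly_def inverse_eq_divide)
  finally show ?thesis
    using assms by auto
qed

lemma subst_ratfun_inverse_root_t:
  assumes "q \<noteq> 0"
  shows "subst_ratfun (to_fract p / to_fract q) (1 / root_t) =
           eval_poly p (1 / root_t) / eval_poly q (1 / root_t)"
proof -
  let ?F = "to_fract p / to_fract q"
  obtain a b where ab: "quot_of_fract ?F = (a, b)"
    by force
  have b: "b \<noteq> 0"
    using snd_quot_of_fract_nonzero[of ?F] ab by simp
  have "?F = to_fract a / to_fract b"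
    by (metis Fract_conv_to_fract Fract_quot_of_fract ab fst_conv snd_conv)
  hence "to_fract (p * b) = to_fract (a * q)"
    using assms b by (simp add: frac_eq_eq)
  hence "p * b = a * q"
    by (simp only: to_fract_eq_iff)
  hence "eval_poly p (1 / root_t) * eval_poly b (1 / root_t) =
         eval_poly a (1 / root_t) * eval_poly q (1 / root_t)"
    by (metis eval_poly_mult)
  thus ?thesis
    using assms b eval_poly_inverse_root_t_nonzero
    by (simp add: subst_ratfun_def ab frac_eq_eq)
qed

end

theory Submission
  imports Defs
begin

text \<open>
  With \<open>s = t\<^sup>1\<^sup>/\<^sup>r\<close> as the variable, the coefficient of \<open>s\<^sup>k\<close> in the rational Ehrhart series of \<open>P\<close> is
  the number of lattice points in the \<open>k\<close>-th dilate of \<open>(1/r) P\<close>. These points are the lattice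
  points at height \<open>k\<close> in the cone \<open>K\<close> over \<open>(1/r) P \<times> {1}\<close>, and the lattice points of the open
  polytope are those of the interior of \<open>K\<close>. Since \<open>(m/r) P\<close> is a lattice polytope, \<open>K\<close> is generated
  by finitely many lattice vectors, all at height \<open>m\<close>. So everything follows from a
  statement about cones, \<open>cone_series_reciprocity\<close>: the two height generating functions of \<open>K\<close> and
  of its interior become polynomials after multiplication by \<open>(1 - s\<^sup>m)\<^sup>D\<close>, where \<open>D = d + 1\<close>, and these
  polynomials are obtained from each other by reversing the coefficients \<open>0, \<dots>, m D\<close>.

  For a half-open simplicial cone, generated by a basis \<open>B\<close> of \<open>D\<close> of the generators, this is elementary.
  Each lattice point is uniquely a lattice point of the half-open fundamental box plus a
  nonnegative integer combination of \<open>B\<close>, so the polynomial counts the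
  lattice points of the box by height (\<open>level_series_prism\<close>). The map \<open>x \<mapsto> \<Sum>B - x\<close> sends the box to
  the box in which the included and the excluded facets have changed roles, and sends height \<open>k\<close> to
  height \<open>m D - k\<close> (\<open>box_series_reflect\<close>).

  It remains to decompose \<open>K\<close> into half-open simplicial cones such that exchanging the included and
  the excluded facets of every piece yields a decomposition of the interior of \<open>K\<close>
  (\<open>cone_half_open_decomposition\<close>). Take generic weights on the generators. The
  bases \<open>B\<close> whose linear interpolant of the weights lies strictly below the weights of all other generators form a
  regular triangulation, in the sense that a generic point of \<open>K\<close> has nonnegative coordinates
  with respect to exactly one of them. This is linear programming duality: such a basis is an optimal one
  for writing the point as a nonnegative combination of generators at least cost. For an arbitrary point \<open>x\<close> and a generic
  direction \<open>q\<close> in the interior of \<open>K\<close>, apply this to \<open>x + \<epsilon> q\<close> and to \<open>x - \<epsilon> q\<close> for small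
  \<open>\<epsilon> > 0\<close>. The first point lies in \<open>K\<close> iff \<open>x\<close> does, the second iff \<open>x\<close> lies in the interior; and
  the condition that the perturbed point has nonnegative coordinates with respect to \<open>B\<close> says
  that \<open>x\<close> lies in a half-open cone whose excluded facets are determined by the signs of the coordinates of
  \<open>q\<close> or of \<open>- q\<close>, respectively.
\<close>

section \<open>Coordinates and finitely generated cones\<close>

abbreviation coord :: "'a::euclidean_space set \<Rightarrow> 'a \<Rightarrow> 'a \<Rightarrow> real" where
  "coord B b y \<equiv> representation B y b"

definition is_basis :: "'a::euclidean_space set \<Rightarrow> bool" where
  "is_basis B \<longleftrightarrow> independent B \<and> span B = UNIV"

lemma is_basis_finite: "is_basis B \<Longrightarrow> finite B"
  by (simp add: is_basis_def independent_imp_finite)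

lemma is_basis_card: "is_basis (B :: 'a::euclidean_space set) \<Longrightarrow> card B = DIM('a)"
  unfolding is_basis_def by (metis dim_UNIV dim_span_eq_card_independent)

lemma is_basis_if_spanning:
  fixes S :: "'a::euclidean_space set"
  assumes "finite S" "span S = UNIV" "card S \<le> DIM('a)"
  shows "is_basis S"
  using card_le_dim_spanning[of S UNIV] assms by (auto simp: is_basis_def)

lemma coord_add: "is_basis B \<Longrightarrow> coord B b (x + y) = coord B b x + coord B b y"
  by (simp add: is_basis_def representation_add)

lemma coord_diff: "is_basis B \<Longrightarrow> coord B b (x - y) = coord B b x - coord B b y"
  by (simp add: is_basis_def representation_diff)

lemma coord_minus: "is_basis B \<Longrightarrow> coord B b (- x) = - coord B b x"
  by (simp add: is_basis_def representation_neg)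

lemma coord_scaleR: "is_basis B \<Longrightarrow> coord B b (c *\<^sub>R x) = c * coord B b x"
  by (simp add: is_basis_def representation_scale)

lemma coord_sum: "is_basis B \<Longrightarrow> coord B b (sum f S) = (\<Sum>i\<in>S. coord B b (f i))"
  by (simp add: is_basis_def representation_sum)

lemma coord_basis: "is_basis B \<Longrightarrow> c \<in> B \<Longrightarrow> coord B b c = (if b = c then 1 else 0)"
  by (simp add: is_basis_def representation_basis)

lemma sum_coord: "is_basis B \<Longrightarrow> (\<Sum>b\<in>B. coord B b x *\<^sub>R b) = x"
  using real_vector.sum_representation_eq[of B x B] is_basis_finite[of B]
  by (simp add: is_basis_def)

lemma coord_combination:
  assumes "is_basis B" "b \<in> B"
  shows "coord B b (\<Sum>c\<in>B. f c *\<^sub>R c) = f b"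
proof -
  have "coord B b (\<Sum>c\<in>B. f c *\<^sub>R c) = (\<Sum>c\<in>B. if c = b then f b else 0)"
    unfolding coord_sum[OF assms(1)]
    by (intro sum.cong) (auto simp: coord_scaleR coord_basis assms)
  thus ?thesis
    using assms(2) is_basis_finite[OF assms(1)] by simp
qed

lemma convex_cone_hull_finite:
  assumes "finite S"
  shows "convex_cone hull S = {\<Sum>g\<in>S. u g *\<^sub>R g |u. \<forall>g\<in>S. 0 \<le> u g}"
proof (rule hull_unique)
  show "S \<subseteq> {\<Sum>g\<in>S. u g *\<^sub>R g |u. \<forall>g\<in>S. 0 \<le> u g}"
  proof
    fix s assume s: "s \<in> S"
    have "(\<Sum>g\<in>S. (if g = s then 1 else 0) *\<^sub>R g) = (\<Sum>g\<in>S. if g = s then s else 0)"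
      by (intro sum.cong) auto
    also have "\<dots> = s"
      using s assms by simp
    finally show "s \<in> {\<Sum>g\<in>S. u g *\<^sub>R g |u. \<forall>g\<in>S. 0 \<le> u g}"
      by (intro CollectI exI[of _ "\<lambda>g. if g = s then 1 else 0"]) auto
  qed
next
  show "convex_cone {\<Sum>g\<in>S. u g *\<^sub>R g |u. \<forall>g\<in>S. 0 \<le> u g}"
    unfolding convex_cone_iff
  proof (intro conjI ballI allI impI)
    show "0 \<in> {\<Sum>g\<in>S. u g *\<^sub>R g |u. \<forall>g\<in>S. 0 \<le> u g}"
      by (intro CollectI exI[of _ "\<lambda>_. 0"]) auto
  next
    fix x y assume "x \<in> {\<Sum>g\<in>S. u g *\<^sub>R g |u. \<forall>g\<in>S. 0 \<le> u g}"
      "y \<in> {\<Sum>g\<in>S. u g *\<^sub>R g |u. \<forall>g\<in>S. 0 \<le> u g}"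
    then obtain u v where "x = (\<Sum>g\<in>S. u g *\<^sub>R g)" "y = (\<Sum>g\<in>S. v g *\<^sub>R g)"
      "\<forall>g\<in>S. 0 \<le> u g" "\<forall>g\<in>S. 0 \<le> v g"
      by blast
    thus "x + y \<in> {\<Sum>g\<in>S. u g *\<^sub>R g |u. \<forall>g\<in>S. 0 \<le> u g}"
      by (intro CollectI exI[of _ "\<lambda>g. u g + v g"]) (auto simp: scaleR_left_distrib sum.distrib)
  next
    fix x and c :: real assume "x \<in> {\<Sum>g\<in>S. u g *\<^sub>R g |u. \<forall>g\<in>S. 0 \<le> u g}" "0 \<le> c"
    then obtain u where "x = (\<Sum>g\<in>S. u g *\<^sub>R g)" "\<forall>g\<in>S. 0 \<le> u g"
      by blast
    thus "c *\<^sub>R x \<in> {\<Sum>g\<in>S. u g *\<^sub>R g |u. \<forall>g\<in>S. 0 \<le> u g}"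
      using \<open>0 \<le> c\<close>
      by (intro CollectI exI[of _ "\<lambda>g. c * u g"]) (auto simp: scaleR_sum_right)
  qed
next
  fix T assume T: "S \<subseteq> T" "convex_cone T"
  show "{\<Sum>g\<in>S. u g *\<^sub>R g |u. \<forall>g\<in>S. 0 \<le> u g} \<subseteq> T"
  proof safe
    fix u :: "'a \<Rightarrow> real" assume u: "\<forall>g\<in>S. 0 \<le> u g"
    from assms T(1) u show "(\<Sum>g\<in>S. u g *\<^sub>R g) \<in> T"
      by (induction S rule: finite_induct)
         (auto intro!: convex_cone_add convex_cone_scaleR convex_cone_contains_0 T(2))
  qed
qed

section \<open>Generic points and generic weights\<close>

text \<open>It would suffice to avoid the hyperplanes spanned by generators; quantifying over all sets with a
  proper span is equivalent when \<open>G\<close> spans the space, and saves extending such a set to one that spans a hyperplane.\<close>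

definition generic :: "'a::euclidean_space set \<Rightarrow> 'a \<Rightarrow> bool" where
  "generic G y \<longleftrightarrow> (\<forall>S\<subseteq>G. span S \<noteq> UNIV \<longrightarrow> y \<notin> span S)"

lemma generic_minus: "generic G q \<Longrightarrow> generic G (- q)"
  unfolding generic_def by (metis add.inverse_inverse span_neg)

text \<open>Otherwise \<open>y\<close> would lie in the span of the remaining basis vectors.\<close>

lemma coord_generic_nonzero:
  assumes "generic G y" "is_basis B" "B \<subseteq> G" "b \<in> B"
  shows "coord B b y \<noteq> 0"
proof
  assume 0: "coord B b y = 0"
  have "span (B - {b}) \<noteq> UNIV"
    using assms(2,4) unfolding is_basis_def dependent_def by blast
  moreover have "y = (\<Sum>c\<in>B - {b}. coord B c y *\<^sub>R c)"
    using sum_coord[OF assms(2), of y] sum.remove[OF is_basis_finite[OF assms(2)] assms(4)] 0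
    by (metis (no_types, lifting) add_0 scale_zero_left)
  hence "y \<in> span (B - {b})"
    by (metis (no_types, lifting) span_base span_scale span_sum)
  ultimately show False
    using assms unfolding generic_def by (metis Diff_subset order_trans)
qed

text \<open>The points that are not generic lie in a finite union of proper subspaces, which is a null set.\<close>

lemma exists_generic:
  fixes G :: "'a::euclidean_space set"
  assumes "finite G" "open U" "U \<noteq> {}"
  shows "\<exists>q\<in>U. generic G q"
proof (rule ccontr)
  assume "\<not> ?thesis"
  hence "U \<subseteq> (\<Union>S\<in>{S\<in>Pow G. span S \<noteq> UNIV}. span S)"
    by (auto simp: generic_def)
  moreover have "negligible (\<Union>S\<in>{S\<in>Pow G. span S \<noteq> UNIV}. span S)"
  proof (rule negligible_Union)
    show "finite (span ` {S\<in>Pow G. span S \<noteq> UNIV})"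
      using assms(1) by simp
  next
    fix t assume "t \<in> span ` {S\<in>Pow G. span S \<noteq> UNIV}"
    then obtain S where S: "t = span S" "span S \<noteq> UNIV"
      by blast
    hence "dim t < DIM('a)"
      by (metis dim_eq_full dim_span dim_subset_UNIV le_neq_implies_less)
    thus "negligible t"
      by (rule negligible_lowdim)
  qed
  ultimately show False
    using assms(2,3) open_not_negligible negligible_subset by blast
qed

text \<open>A line in direction \<open>q\<close> meets a subspace not containing \<open>q\<close> at most once.\<close>

lemma eventually_generic_perturbation:
  fixes G :: "'a::euclidean_space set"
  assumes "finite G" "generic G q"
  shows "eventually (\<lambda>\<epsilon>::real. generic G (x + \<epsilon> *\<^sub>R q)) (at_right 0)"
proof -
  have "eventually (\<lambda>\<epsilon>::real. x + \<epsilon> *\<^sub>R q \<notin> span S) (at_right 0)"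
    if S: "S \<subseteq> G" "span S \<noteq> UNIV" for S
  proof (cases "\<exists>\<delta>>0. x + \<delta> *\<^sub>R q \<in> span S")
    case False
    show ?thesis
      using eventually_at_right_less[of "0::real"] by eventually_elim (use False in auto)
  next
    case True
    then obtain \<delta> where \<delta>: "\<delta> > 0" "x + \<delta> *\<^sub>R q \<in> span S"
      by blast
    have "x + \<epsilon> *\<^sub>R q \<notin> span S" if "\<epsilon> < \<delta>" for \<epsilon>
    proof
      assume "x + \<epsilon> *\<^sub>R q \<in> span S"
      hence "(x + \<delta> *\<^sub>R q) - (x + \<epsilon> *\<^sub>R q) \<in> span S"
        using \<delta>(2) span_diff by blast
      hence "(\<delta> - \<epsilon>) *\<^sub>R q \<in> span S"
        by (simp add: algebra_simps)
      hence "q \<in> span S"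
        using that span_scale[of "(\<delta> - \<epsilon>) *\<^sub>R q" S "inverse (\<delta> - \<epsilon>)"] by simp
      thus False
        using assms(2) S by (auto simp: generic_def)
    qed
    moreover have "eventually (\<lambda>\<epsilon>. \<epsilon> < \<delta>) (at_right 0)"
      using \<delta>(1) by (auto simp: eventually_at_right_field)
    ultimately show ?thesis
      by (rule eventually_mono[rotated])
  qed
  hence "eventually (\<lambda>\<epsilon>::real. \<forall>S\<in>{S\<in>Pow G. span S \<noteq> UNIV}. x + \<epsilon> *\<^sub>R q \<notin> span S) (at_right 0)"
    using assms(1) by (intro eventually_ball_finite) auto
  thus ?thesis
    by eventually_elim (auto simp: generic_def)
qed

text \<open>Finitely many hyperplanes do not cover the space of weights: the values of \<open>w\<close> are chosen one
  after the other, avoiding finitely many forbidden values each time.\<close>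

lemma exists_nonvanishing_weights:
  fixes C :: "('a \<Rightarrow> real) set"
  assumes "finite V" "finite C" "\<And>c. c \<in> C \<Longrightarrow> \<exists>v\<in>V. c v \<noteq> 0"
  shows "\<exists>w. \<forall>c\<in>C. (\<Sum>v\<in>V. c v * w v) \<noteq> 0"
  using assms
proof (induction V arbitrary: C rule: finite_induct)
  case empty
  thus ?case by auto
next
  case (insert x V)
  have "\<exists>w. \<forall>c\<in>{c\<in>C. \<exists>v\<in>V. c v \<noteq> 0}. (\<Sum>v\<in>V. c v * w v) \<noteq> 0"
    by (rule insert.IH) (use insert.prems in auto)
  then obtain w where w: "\<And>c. c \<in> C \<Longrightarrow> \<exists>v\<in>V. c v \<noteq> 0 \<Longrightarrow> (\<Sum>v\<in>V. c v * w v) \<noteq> 0"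
    by blast
  \<comment> \<open>The values that make one of the forms vanish. A form not involving \<open>x\<close> contributes
     the value \<open>0\<close>, by the convention on division; excluding it does no harm.\<close>
  define bad where "bad = (\<lambda>c. - (\<Sum>v\<in>V. c v * w v) / c x) ` C"
  have "finite bad"
    unfolding bad_def using insert.prems by blast
  then obtain a where a: "a \<notin> bad"
    using ex_new_if_finite[OF infinite_UNIV_char_0] by blast
  have "(\<Sum>v\<in>insert x V. c v * (w(x := a)) v) \<noteq> 0" if c: "c \<in> C" for c
  proof -
    have "(\<Sum>v\<in>V. c v * (w(x := a)) v) = (\<Sum>v\<in>V. c v * w v)"
      using insert.hyps by (intro sum.cong) auto
    hence eq: "(\<Sum>v\<in>insert x V. c v * (w(x := a)) v) = c x * a + (\<Sum>v\<in>V. c v * w v)"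
      using insert.hyps by simp
    show ?thesis
    proof (cases "c x = 0")
      case True
      hence "\<exists>v\<in>V. c v \<noteq> 0"
        using insert.prems(2)[OF c] by auto
      thus ?thesis
        using w[OF c] eq True by simp
    next
      case False
      have "a \<noteq> - (\<Sum>v\<in>V. c v * w v) / c x"
        using a c by (auto simp: bad_def)
      thus ?thesis
        using False unfolding eq by (auto simp: field_simps)
    qed
  qed
  thus ?case by blast
qed

section \<open>Regular triangulation of a cone\<close>

text \<open>The value at \<open>y\<close> of the linear function that agrees with the weights on the basis \<open>B\<close>. It is also
  the cost of the representation of \<open>y\<close> by \<open>B\<close> when each generator \<open>g\<close> costs \<open>w g\<close>; the two readings are
  dual to each other.\<close>

definition interpolant :: "('a::euclidean_space \<Rightarrow> real) \<Rightarrow> 'a set \<Rightarrow> 'a \<Rightarrow> real" where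
  "interpolant w B y = (\<Sum>b\<in>B. coord B b y * w b)"

text \<open>The maximal simplices of the regular triangulation induced by \<open>w\<close>: lift each generator \<open>g\<close>
  to height \<open>w g\<close> and project the lower facets of the lifted cone. For linear programming, these are
  the dual feasible bases.\<close>

definition regular_bases :: "('a::euclidean_space \<Rightarrow> real) \<Rightarrow> 'a set \<Rightarrow> 'a set set" where
  "regular_bases w G = {B. is_basis B \<and> B \<subseteq> G \<and> (\<forall>v\<in>G - B. interpolant w B v < w v)}"

text \<open>No further generator lies on the hyperplane spanned by a lifted basis. This makes the regular
  subdivision a triangulation.\<close>

definition generic_weights :: "'a::euclidean_space set \<Rightarrow> ('a \<Rightarrow> real) \<Rightarrow> bool" where
  "generic_weights G w \<longleftrightarrow> (\<forall>B\<subseteq>G. is_basis B \<longrightarrow> (\<forall>v\<in>G - B. interpolant w B v \<noteq> w v))"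

lemma interpolant_combination:
  assumes "is_basis B"
  shows "interpolant w B (\<Sum>g\<in>S. u g *\<^sub>R g) = (\<Sum>g\<in>S. u g * interpolant w B g)"
proof -
  have "interpolant w B (\<Sum>g\<in>S. u g *\<^sub>R g) = (\<Sum>b\<in>B. \<Sum>g\<in>S. u g * coord B b g * w b)"
    by (simp add: interpolant_def coord_sum[OF assms] coord_scaleR[OF assms] sum_distrib_right)
  also have "\<dots> = (\<Sum>g\<in>S. \<Sum>b\<in>B. u g * coord B b g * w b)"
    by (rule sum.swap)
  also have "\<dots> = (\<Sum>g\<in>S. u g * interpolant w B g)"
    by (simp add: interpolant_def sum_distrib_left mult.assoc)
  finally show ?thesis .
qed

lemma interpolant_basis:
  assumes "is_basis B" "c \<in> B"
  shows "interpolant w B c = w c"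
proof -
  have "interpolant w B c = (\<Sum>b\<in>B. if b = c then w b else 0)"
    unfolding interpolant_def by (intro sum.cong) (auto simp: coord_basis assms)
  thus ?thesis
    using assms(2) is_basis_finite[OF assms(1)] by simp
qed

text \<open>For a basis \<open>B\<close> and a generator \<open>v\<close> outside \<open>B\<close>, the forbidden equation is a linear form in \<open>w\<close> with
  coefficient \<open>-1\<close> at \<open>v\<close>, hence nonzero.\<close>

lemma exists_generic_weights:
  fixes G :: "'a::euclidean_space set"
  assumes "finite G"
  shows "\<exists>w. generic_weights G w"
proof -
  define c where "c = (\<lambda>(B :: 'a set, v) g. (if g \<in> B then coord B g v else 0) - (if g = v then 1 else 0 :: real))"
  define I where "I = (SIGMA B:{B\<in>Pow G. is_basis B}. G - B)"
  have "finite (c ` I)"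
    using assms by (auto simp: I_def)
  moreover have "\<exists>g\<in>G. c i g \<noteq> 0" if "i \<in> I" for i
    using that by (auto simp: I_def c_def intro!: bexI[of _ "snd i"])
  ultimately have "\<exists>w. \<forall>k\<in>c ` I. (\<Sum>g\<in>G. k g * w g) \<noteq> 0"
    by (intro exists_nonvanishing_weights[OF assms]) (auto simp del: split_paired_Ex)
  then obtain w where w: "\<And>i. i \<in> I \<Longrightarrow> (\<Sum>g\<in>G. c i g * w g) \<noteq> 0"
    by blast
  have "interpolant w B v \<noteq> w v" if "B \<subseteq> G" "is_basis B" "v \<in> G - B" for B v
  proof -
    have "(\<Sum>g\<in>G. c (B, v) g * w g) =
        (\<Sum>g\<in>G. if g \<in> B then coord B g v * w g else 0) - (\<Sum>g\<in>G. if g = v then w g else 0)"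
      unfolding sum_subtractf[symmetric] by (intro sum.cong) (auto simp: c_def algebra_simps)
    also have "(\<Sum>g\<in>G. if g \<in> B then coord B g v * w g else 0) = interpolant w B v"
      unfolding interpolant_def using assms that(1) by (simp add: sum.If_cases Int_absorb1)
    also have "(\<Sum>g\<in>G. if g = v then w g else 0) = w v"
      using assms that(3) by simp
    finally show ?thesis
      using w[of "(B, v)"] that by (auto simp: I_def)
  qed
  thus ?thesis
    by (auto simp: generic_weights_def)
qed

lemma regular_bases_interpolant_le:
  assumes "B \<in> regular_bases w G" "v \<in> G"
  shows "interpolant w B v \<le> w v"
  using assms interpolant_basis[of B v w] by (cases "v \<in> B") (auto simp: regular_bases_def less_imp_le)

text \<open>Weak duality: for each of the two bases, its interpolant at \<open>y\<close> is at most the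
  cost of the representation of \<open>y\<close> by the other basis, so the costs agree. A
  vector of \<open>C\<close> outside \<open>B\<close> would make one inequality strict, as all coordinates of a generic
  point are nonzero.\<close>

lemma regular_bases_unique:
  assumes y: "generic G y"
    and B: "B \<in> regular_bases w G" "\<And>b. b \<in> B \<Longrightarrow> 0 \<le> coord B b y"
    and C: "C \<in> regular_bases w G" "\<And>c. c \<in> C \<Longrightarrow> 0 \<le> coord C c y"
  shows "B = C"
proof -
  have bases: "is_basis B" "is_basis C" "B \<subseteq> G" "C \<subseteq> G"
    using B C by (auto simp: regular_bases_def)
  have le: "interpolant w B' y \<le> interpolant w C' y"
    if "B' \<in> regular_bases w G" "C' \<in> regular_bases w G" "\<And>c. c \<in> C' \<Longrightarrow> 0 \<le> coord C' c y" for B' C'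
  proof -
    have bas: "is_basis B'" "is_basis C'" "C' \<subseteq> G"
      using that by (auto simp: regular_bases_def)
    have "interpolant w B' y = (\<Sum>c\<in>C'. coord C' c y * interpolant w B' c)"
      using interpolant_combination[OF bas(1), of w "\<lambda>c. coord C' c y" C'] sum_coord[OF bas(2), of y] by simp
    also have "\<dots> \<le> (\<Sum>c\<in>C'. coord C' c y * w c)"
      by (intro sum_mono mult_left_mono regular_bases_interpolant_le[OF that(1)])
         (use that bas in auto)
    finally show ?thesis
      by (simp add: interpolant_def)
  qed
  have "C \<subseteq> B"
  proof
    fix c assume c: "c \<in> C"
    show "c \<in> B"
    proof (rule ccontr)
      assume "c \<notin> B"
      hence less: "interpolant w B c < w c"
        using B(1) c bases by (auto simp: regular_bases_def)
      have pos: "coord C c y > 0"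
        using C(2)[OF c] coord_generic_nonzero[OF y bases(2,4) c] by simp
      have "interpolant w B y = (\<Sum>c\<in>C. coord C c y * interpolant w B c)"
        using interpolant_combination[OF bases(1), of w "\<lambda>c. coord C c y" C] sum_coord[OF bases(2), of y] by simp
      also have "\<dots> < (\<Sum>c\<in>C. coord C c y * w c)"
      proof (rule sum_strict_mono_ex1)
        show "\<forall>c\<in>C. coord C c y * interpolant w B c \<le> coord C c y * w c"
          by (intro ballI mult_left_mono regular_bases_interpolant_le[OF B(1)]) (use C bases in auto)
        show "\<exists>c\<in>C. coord C c y * interpolant w B c < coord C c y * w c"
          using c less pos by (intro bexI[of _ c]) simp_all
      qed (rule is_basis_finite[OF bases(2)])
      also have "\<dots> = interpolant w C y"
        by (simp add: interpolant_def)
      also have "\<dots> \<le> interpolant w B y"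
        by (rule le[OF C(1) B(1) B(2)])
      finally show False by simp
    qed
  qed
  thus ?thesis
    using bases is_basis_card is_basis_finite card_subset_eq by metis
qed

text \<open>Caratheodory's theorem for cones: the generators lie in an affine hyperplane, so at most \<open>DIM('a)\<close>
  of them are needed to represent \<open>y\<close>, and genericity of \<open>y\<close> forces those to be a basis.\<close>

lemma exists_nonneg_basis:
  fixes G :: "'a::euclidean_space set"
  assumes G: "finite G" "linear ht" "\<And>g. g \<in> G \<Longrightarrow> ht g = (1 :: real)"
    and y: "generic G y" "y \<in> convex_cone hull G"
  shows "\<exists>B\<subseteq>G. is_basis B \<and> (\<forall>b\<in>B. 0 \<le> coord B b y)"
proof -
  have basis: "\<exists>B\<subseteq>G. is_basis B \<and> (\<forall>b\<in>B. 0 \<le> coord B b y)"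
    if S: "finite S" "S \<subseteq> G" "card S \<le> DIM('a)" "\<forall>x\<in>S. 0 \<le> u x" and eq: "(\<Sum>v\<in>S. u v *\<^sub>R v) = y" for S u
  proof -
    have "y \<in> span S"
      unfolding eq[symmetric] by (intro span_sum span_scale span_base)
    hence "is_basis S"
      using y S by (intro is_basis_if_spanning) (auto simp: generic_def)
    thus ?thesis
      using coord_combination[of S _ u] S eq by auto
  qed
  show ?thesis
  proof (cases "y = 0")
    case True
    thus ?thesis by (intro basis[of "{}" "\<lambda>_. 0"]) auto
  next
    case False
    with y(2) obtain x c where x: "x \<in> convex hull G" "c \<ge> 0" "y = c *\<^sub>R x"
      unfolding convex_cone_hull_convex_hull by auto
    then obtain S u where S: "finite S" "S \<subseteq> G" "card S \<le> aff_dim G + 1" "\<forall>x\<in>S. 0 \<le> u x"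
      "(\<Sum>v\<in>S. u v *\<^sub>R v) = x"
      unfolding convex_hull_caratheodory_aff_dim by auto
    have "affine hull G \<subseteq> {x. ht x = 1}"
    proof (rule hull_minimal)
      show "affine {x. ht x = 1}"
        by (auto simp: affine_def linear_add[OF G(2)] linear_scale[OF G(2)])
    qed (use G in auto)
    moreover have "ht 0 = 0"
      using G(2) by (rule linear_0)
    ultimately have "affine hull G \<noteq> UNIV"
      by (auto simp: subset_iff dest: spec[of _ 0])
    hence "aff_dim G \<noteq> int DIM('a)"
      by (simp add: aff_dim_eq_full)
    hence "aff_dim G < int DIM('a)"
      using aff_dim_le_DIM[of G] by simp
    with S(3) have "card S \<le> DIM('a)"
      by linarith
    thus ?thesis
      using S x by (intro basis[of S "\<lambda>v. c * u v"]) (auto simp: scaleR_sum_right simp flip: scaleR_scaleR)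
  qed
qed

text \<open>The pivot step of the simplex method. Giving \<open>v\<close> the coefficient \<open>\<theta>\<close> changes the cost by
  \<open>\<theta> * (w v - interpolant w B v)\<close>, which is negative; \<open>\<theta>\<close> is chosen as large as possible, so that one vector
  leaves the basis. Some coordinate of \<open>v\<close> is positive because the coordinates sum up to \<open>ht v = 1\<close>.\<close>

lemma pivot_decreases_interpolant:
  fixes G :: "'a::euclidean_space set"
  assumes G: "linear ht" "\<And>g. g \<in> G \<Longrightarrow> ht g = (1 :: real)"
    and y: "generic G y"
    and B: "is_basis B" "B \<subseteq> G" "\<And>b. b \<in> B \<Longrightarrow> 0 \<le> coord B b y"
    and v: "v \<in> G - B" "w v < interpolant w B v"
  shows "\<exists>C\<subseteq>G. is_basis C \<and> (\<forall>c\<in>C. 0 \<le> coord C c y) \<and> interpolant w C y < interpolant w B y"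
proof -
  note fin = is_basis_finite[OF B(1)]
  have pos: "coord B b y > 0" if "b \<in> B" for b
    using B(3)[OF that] coord_generic_nonzero[OF y B(1,2) that] by simp
  define R where "R = {b\<in>B. coord B b v > 0}"
  have "ht v = (\<Sum>b\<in>B. coord B b v * ht b)"
    using linear_sum[OF G(1), of "\<lambda>b. coord B b v *\<^sub>R b" B] sum_coord[OF B(1), of v] 
    by (simp add: linear_scale[OF G(1)])
  also have "\<dots> = (\<Sum>b\<in>B. coord B b v)"
    using B(2) by (intro sum.cong) (auto simp: G(2))
  finally have "(\<Sum>b\<in>B. coord B b v) = 1"
    using G(2) v by simp
  hence "R \<noteq> {}"
    using sum_nonpos[of B "\<lambda>b. coord B b v"] by (force simp: R_def)
  \<comment> \<open>The largest coefficient of \<open>v\<close> that keeps all other coefficients nonnegative.\<close>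
  define \<theta> where "\<theta> = Min ((\<lambda>b. coord B b y / coord B b v) ` R)"
  have finR: "finite R"
    using fin by (simp add: R_def)
  have "\<theta> \<in> (\<lambda>b. coord B b y / coord B b v) ` R"
    unfolding \<theta>_def using finR \<open>R \<noteq> {}\<close> by (intro Min_in) auto
  then obtain a where a: "a \<in> R" "\<theta> = coord B a y / coord B a v"
    by blast
  have \<theta>: "\<theta> > 0"
    using a pos by (auto simp: R_def)
  have \<theta>_le: "\<theta> * coord B b v \<le> coord B b y" if "b \<in> B" for b
  proof (cases "b \<in> R")
    case True
    hence "\<theta> \<le> coord B b y / coord B b v"
      unfolding \<theta>_def using finR by (intro Min_le) auto
    thus ?thesis
      using True by (simp add: R_def field_simps)
  next
    case False
    hence "\<theta> * coord B b v \<le> 0"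
      using \<theta> that by (auto simp: R_def mult_nonneg_nonpos)
    thus ?thesis
      using pos[OF that] by simp
  qed
  have aB: "a \<in> B" "\<theta> * coord B a v = coord B a y"
    using a by (auto simp: R_def)
  define C where "C = insert v (B - {a})"
  define u where "u = (\<lambda>c. if c = v then \<theta> else coord B c y - \<theta> * coord B c v)"
  have C: "finite C" "C \<subseteq> G" "card C = DIM('a)"
    using fin B(2) v aB is_basis_card[OF B(1)] card_Suc_Diff1[of B a] by (auto simp: C_def)
  have u: "u c \<ge> 0" if "c \<in> C" for c
    using that \<theta> \<theta>_le[of c] by (auto simp: u_def C_def)
  have sum_C: "(\<Sum>c\<in>C. u c *\<^sub>R f c) = \<theta> *\<^sub>R f v + (\<Sum>b\<in>B. (coord B b y - \<theta> * coord B b v) *\<^sub>R f b)"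
    for f :: "'a \<Rightarrow> 'b::real_vector"
  proof -
    have "(\<Sum>b\<in>B. (coord B b y - \<theta> * coord B b v) *\<^sub>R f b) =
        (\<Sum>b\<in>B - {a}. (coord B b y - \<theta> * coord B b v) *\<^sub>R f b)"
      using aB by (simp add: sum.remove[OF fin aB(1)])
    also have "\<dots> = (\<Sum>b\<in>B - {a}. u b *\<^sub>R f b)"
      using v by (intro sum.cong) (auto simp: u_def)
    finally show ?thesis
      using v fin by (simp add: C_def u_def)
  qed
  have "(\<Sum>c\<in>C. u c *\<^sub>R c) =
      \<theta> *\<^sub>R v + ((\<Sum>b\<in>B. coord B b y *\<^sub>R b) - \<theta> *\<^sub>R (\<Sum>b\<in>B. coord B b v *\<^sub>R b))"
    unfolding sum_C[of "\<lambda>c. c"] by (simp add: scaleR_left_diff_distrib sum_subtractf scaleR_sum_right)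
  hence eq: "(\<Sum>c\<in>C. u c *\<^sub>R c) = y"
    by (simp add: sum_coord[OF B(1)])
  have "y \<in> span C"
    unfolding eq[symmetric] by (intro span_sum span_scale span_base)
  hence basis: "is_basis C"
    using y C by (intro is_basis_if_spanning) (auto simp: generic_def)
  have coord: "coord C c y = u c" if "c \<in> C" for c
    using coord_combination[OF basis that, of u] by (simp add: eq)
  have "interpolant w C y = (\<Sum>c\<in>C. u c *\<^sub>R w c)"
    unfolding interpolant_def using coord by simp
  also have "\<dots> = \<theta> * w v + (interpolant w B y - \<theta> * interpolant w B v)"
    unfolding sum_C by (simp add: interpolant_def left_diff_distrib sum_subtractf sum_distrib_left mult.assoc)
  also have "\<dots> < interpolant w B y"
    using \<theta> v by simp
  finally show ?thesis
    using C basis coord u by auto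
qed

text \<open>Strong duality: among the finitely many bases representing \<open>y\<close> with nonnegative coordinates, one of least
  cost is dual feasible, since otherwise a pivot would lower the cost.\<close>

lemma regular_bases_cover:
  fixes G :: "'a::euclidean_space set"
  assumes G: "finite G" "linear ht" "\<And>g. g \<in> G \<Longrightarrow> ht g = (1 :: real)"
    and w: "generic_weights G w"
    and y: "generic G y" "y \<in> convex_cone hull G"
  shows "\<exists>B\<in>regular_bases w G. \<forall>b\<in>B. 0 \<le> coord B b y"
proof -
  define F where "F = {B\<in>Pow G. is_basis B \<and> (\<forall>b\<in>B. 0 \<le> coord B b y)}"
  have "finite F" "F \<noteq> {}"
    using G(1) exists_nonneg_basis[OF G y] by (auto simp: F_def)
  then obtain B where B: "B \<in> F" "\<And>C. C \<in> F \<Longrightarrow> interpolant w B y \<le> interpolant w C y"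
    using ex_is_arg_min_if_finite[of F "\<lambda>B. interpolant w B y"] by (auto simp: is_arg_min_linorder)
  have "interpolant w B v < w v" if v: "v \<in> G - B" for v
  proof (rule ccontr)
    assume "\<not> interpolant w B v < w v"
    hence "w v < interpolant w B v"
      using w B v by (auto simp: generic_weights_def F_def less_le)
    then obtain C where "C \<in> F" "interpolant w C y < interpolant w B y"
      using pivot_decreases_interpolant[OF G(2,3) y(1), of B v w] B v by (auto simp: F_def)
    thus False
      using B(2) by force
  qed
  thus ?thesis
    using B by (auto simp: F_def regular_bases_def)
qed

section \<open>Half-open decomposition of a cone and of its interior\<close>

text \<open>The set \<open>N\<close> lists the basis vectors whose coordinate has to be strictly positive. For a simplicial
  cone, these correspond to the excluded facets.\<close>

definition ray :: "'a set \<Rightarrow> 'a \<Rightarrow> real set" where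
  "ray N b = (if b \<in> N then {0<..} else {0..})"

text \<open>Only the sign of \<open>a\<close> matters for small \<open>\<epsilon>\<close>, unless \<open>a = 0\<close>; then the sign of \<open>q\<close> decides.\<close>

lemma eventually_nonneg_perturbation_iff:
  fixes a q :: real
  assumes "q \<noteq> 0"
  shows "eventually (\<lambda>\<epsilon>. 0 \<le> a + \<epsilon> * q \<longleftrightarrow> (if q < 0 then 0 < a else 0 \<le> a)) (at_right 0)"
proof -
  have lim: "((\<lambda>\<epsilon>. a + \<epsilon> * q) \<longlongrightarrow> a + 0 * q) (at_right 0)"
    by (intro tendsto_intros)
  have pos: "eventually (\<lambda>\<epsilon>::real. \<epsilon> > 0) (at_right 0)"
    by (rule eventually_at_right_less)
  consider "a < 0" | "a > 0" | "a = 0"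
    by linarith
  thus ?thesis
  proof cases
    case 1
    hence "eventually (\<lambda>\<epsilon>. a + \<epsilon> * q < 0) (at_right 0)"
      using order_tendstoD(2)[OF lim] by simp
    thus ?thesis
      by eventually_elim (use 1 in auto)
  next
    case 2
    hence "eventually (\<lambda>\<epsilon>. 0 < a + \<epsilon> * q) (at_right 0)"
      using order_tendstoD(1)[OF lim] by simp
    thus ?thesis
      by eventually_elim (use 2 in auto)
  next
    case 3
    show ?thesis
      using pos by eventually_elim (use 3 assms in \<open>auto simp: zero_le_mult_iff\<close>)
  qed
qed

definition half_open_cone :: "'a::euclidean_space set \<Rightarrow> 'a set \<Rightarrow> 'a set" where
  "half_open_cone B N = {x. \<forall>b\<in>B. coord B b x \<in> ray N b}"

text \<open>The vectors opposite to the facets of the cone over \<open>B\<close> that have \<open>q\<close> strictly on their outer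
  side.\<close>

definition visible :: "'a::euclidean_space \<Rightarrow> 'a set \<Rightarrow> 'a set" where
  "visible q B = {b\<in>B. coord B b q < 0}"

lemma visible_minus:
  assumes "generic G q" "is_basis B" "B \<subseteq> G"
  shows "visible (- q) B = B - visible q B"
  using coord_generic_nonzero[OF assms] by (force simp: visible_def coord_minus[OF assms(2)])

lemma eventually_coord_nonneg_iff:
  assumes "generic G q" "is_basis B" "B \<subseteq> G"
  shows "eventually (\<lambda>\<epsilon>::real. (\<forall>b\<in>B. 0 \<le> coord B b (x + \<epsilon> *\<^sub>R q)) \<longleftrightarrow> x \<in> half_open_cone B (visible q B))
    (at_right 0)"
proof -
  have "eventually (\<lambda>\<epsilon>::real. \<forall>b\<in>B. 0 \<le> coord B b x + \<epsilon> * coord B b q \<longleftrightarrow>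
      (if coord B b q < 0 then 0 < coord B b x else 0 \<le> coord B b x)) (at_right 0)"
    using is_basis_finite[OF assms(2)]
    by (intro eventually_ball_finite ballI eventually_nonneg_perturbation_iff coord_generic_nonzero[OF assms]) auto
  thus ?thesis
    by eventually_elim
       (auto simp: half_open_cone_def visible_def ray_def coord_add[OF assms(2)] coord_scaleR[OF assms(2)] split: if_splits)
qed

text \<open>A common point, moved slightly in direction \<open>q\<close>, would be a generic point represented by both bases.\<close>

lemma half_open_cones_disjoint:
  assumes G: "finite G" and q: "generic G q"
    and B: "B \<in> regular_bases w G" and C: "C \<in> regular_bases w G"
    and x: "x \<in> half_open_cone B (visible q B)" "x \<in> half_open_cone C (visible q C)"
  shows "B = C"
proof -
  have "is_basis B" "B \<subseteq> G" "is_basis C" "C \<subseteq> G"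
    using B C by (auto simp: regular_bases_def)
  note ev = eventually_coord_nonneg_iff[OF q this(1,2), of x] eventually_coord_nonneg_iff[OF q this(3,4), of x]
    eventually_generic_perturbation[OF G q, of x]
  have "eventually (\<lambda>\<epsilon>::real. B = C) (at_right 0)"
    using ev
  proof eventually_elim
    case (elim \<epsilon>)
    show ?case
      by (rule regular_bases_unique[OF elim(3) B _ C]) (use elim x in auto)
  qed
  thus ?thesis
    by simp
qed

lemma nonneg_coords_in_cone:
  assumes "is_basis B" "B \<subseteq> G" "\<forall>b\<in>B. 0 \<le> coord B b x"
  shows "x \<in> convex_cone hull G"
proof -
  have "x \<in> convex_cone hull B"
    using assms sum_coord[OF assms(1), of x]
    by (auto simp: convex_cone_hull_finite[OF is_basis_finite[OF assms(1)]]
        intro!: exI[of _ "\<lambda>b. coord B b x"])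
  thus ?thesis
    using hull_mono[OF assms(2)] by blast
qed

lemma eventually_cone_iff_half_open:
  fixes G :: "'a::euclidean_space set"
  assumes G: "finite G" "linear ht" "\<And>g. g \<in> G \<Longrightarrow> ht g = (1 :: real)"
    and w: "generic_weights G w" and q: "generic G q"
  shows "eventually (\<lambda>\<epsilon>::real. x + \<epsilon> *\<^sub>R q \<in> convex_cone hull G \<longleftrightarrow>
    (\<exists>B\<in>regular_bases w G. x \<in> half_open_cone B (visible q B))) (at_right 0)"
proof -
  have "finite (regular_bases w G)"
    by (rule finite_subset[of _ "Pow G"]) (use G in \<open>auto simp: regular_bases_def\<close>)
  hence "eventually (\<lambda>\<epsilon>::real. \<forall>B\<in>regular_bases w G. (\<forall>b\<in>B. 0 \<le> coord B b (x + \<epsilon> *\<^sub>R q)) \<longleftrightarrow>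
      x \<in> half_open_cone B (visible q B)) (at_right 0)"
    by (intro eventually_ball_finite ballI eventually_coord_nonneg_iff[OF q]) (auto simp: regular_bases_def)
  moreover note eventually_generic_perturbation[OF G(1) q, of x]
  ultimately show ?thesis
  proof eventually_elim
    case (elim \<epsilon>)
    have "x + \<epsilon> *\<^sub>R q \<in> convex_cone hull G \<longleftrightarrow>
        (\<exists>B\<in>regular_bases w G. \<forall>b\<in>B. 0 \<le> coord B b (x + \<epsilon> *\<^sub>R q))"
      using regular_bases_cover[OF G w elim(2)] nonneg_coords_in_cone
      by (auto simp: regular_bases_def)
    thus ?case
      using elim(1) by auto
  qed
qed

text \<open>Turns an equivalence that holds for all small \<open>\<epsilon>\<close> into one between statements free of \<open>\<epsilon>\<close>.\<close>

lemma eventually_iff_const: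
  assumes "eventually (\<lambda>x. P x \<longleftrightarrow> Q) F" "F \<noteq> bot"
  shows "Q \<longleftrightarrow> eventually P F"
proof
  assume Q
  from assms(1) show "eventually P F"
    by eventually_elim (use \<open>Q\<close> in simp)
next
  assume "eventually P F"
  with assms(1) have "eventually (\<lambda>_. Q) F"
    by eventually_elim auto
  thus Q
    using assms(2) by simp
qed

text \<open>For the converse direction, \<open>x\<close> is the limit of the points \<open>x + \<epsilon> q\<close> of the closed set \<open>K\<close>.\<close>

lemma mem_convex_cone_iff_perturbed:
  fixes K :: "'a::euclidean_space set"
  assumes K: "convex_cone K" "closed K" and q: "q \<in> K"
  shows "x \<in> K \<longleftrightarrow> eventually (\<lambda>\<epsilon>. x + \<epsilon> *\<^sub>R q \<in> K) (at_right 0)"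
proof
  assume x: "x \<in> K"
  show "eventually (\<lambda>\<epsilon>. x + \<epsilon> *\<^sub>R q \<in> K) (at_right 0)"
    using eventually_at_right_less[of "0::real"]
    by eventually_elim (intro convex_cone_add[OF K(1)] convex_cone_scaleR[OF K(1)] x q less_imp_le)
next
  assume "eventually (\<lambda>\<epsilon>. x + \<epsilon> *\<^sub>R q \<in> K) (at_right 0)"
  moreover have "((\<lambda>\<epsilon>. x + \<epsilon> *\<^sub>R q) \<longlongrightarrow> x + 0 *\<^sub>R q) (at_right 0)"
    by (intro tendsto_intros)
  ultimately show "x \<in> K"
    using Lim_in_closed_set[OF K(2), of "\<lambda>\<epsilon>. x + \<epsilon> *\<^sub>R q" "at_right 0" "x + 0 *\<^sub>R q"] by simp
qed

text \<open>For the converse direction, \<open>x = (x - \<epsilon> q) + \<epsilon> q\<close> is the sum of a point of \<open>K\<close> and an interior point.\<close>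

lemma mem_interior_convex_cone_iff_perturbed:
  fixes K :: "'a::euclidean_space set"
  assumes K: "convex_cone K" and q: "q \<in> interior K"
  shows "x \<in> interior K \<longleftrightarrow> eventually (\<lambda>\<epsilon>. x + \<epsilon> *\<^sub>R (- q) \<in> K) (at_right 0)"
proof
  assume x: "x \<in> interior K"
  have "((\<lambda>\<epsilon>. x + \<epsilon> *\<^sub>R (- q)) \<longlongrightarrow> x + 0 *\<^sub>R (- q)) (at_right 0)"
    by (intro tendsto_intros)
  hence "eventually (\<lambda>\<epsilon>. x + \<epsilon> *\<^sub>R (- q) \<in> interior K) (at_right 0)"
    by (rule topological_tendstoD) (use x in auto)
  thus "eventually (\<lambda>\<epsilon>. x + \<epsilon> *\<^sub>R (- q) \<in> K) (at_right 0)"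
    by eventually_elim (use interior_subset in blast)
next
  assume "eventually (\<lambda>\<epsilon>. x + \<epsilon> *\<^sub>R (- q) \<in> K) (at_right 0)"
  with eventually_at_right_less[of "0::real"]
  have "eventually (\<lambda>\<epsilon>. 0 < \<epsilon> \<and> x + \<epsilon> *\<^sub>R (- q) \<in> K) (at_right 0)"
    by eventually_elim auto
  then obtain \<epsilon> :: real where \<epsilon>: "\<epsilon> > 0" "x + \<epsilon> *\<^sub>R (- q) \<in> K"
    using eventually_happens[of _ "at_right (0::real)"] by auto
  have "(\<lambda>z. (x + \<epsilon> *\<^sub>R (- q)) + \<epsilon> *\<^sub>R z) ` interior K \<subseteq> K"
  proof (rule image_subsetI)
    fix z assume "z \<in> interior K"
    hence "\<epsilon> *\<^sub>R z \<in> K"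
      using \<epsilon>(1) interior_subset by (intro convex_cone_scaleR[OF K]) auto
    with \<epsilon>(2) show "x + \<epsilon> *\<^sub>R (- q) + \<epsilon> *\<^sub>R z \<in> K"
      by (rule convex_cone_add[OF K])
  qed
  moreover have "open ((\<lambda>z. (x + \<epsilon> *\<^sub>R (- q)) + \<epsilon> *\<^sub>R z) ` interior K)"
    using open_affinity[OF open_interior[of K], of \<epsilon> "x + \<epsilon> *\<^sub>R (- q)"] \<epsilon>(1)
    by (simp add: image_image)
  moreover have "x \<in> (\<lambda>z. (x + \<epsilon> *\<^sub>R (- q)) + \<epsilon> *\<^sub>R z) ` interior K"
    using q by (intro image_eqI[of _ _ q]) auto
  ultimately show "x \<in> interior K"
    by (meson interiorI)
qed

text \<open>The same bases serve for both decompositions; passing from \<open>q\<close> to \<open>- q\<close> exchanges the visible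
  facets with the others, because no coordinate of \<open>q\<close> vanishes.\<close>

theorem cone_half_open_decomposition:
  fixes G :: "'a::euclidean_space set"
  assumes G: "finite G" "linear ht" "\<And>g. g \<in> G \<Longrightarrow> ht g = (1 :: real)"
    and w: "generic_weights G w" and q: "generic G q" "q \<in> interior (convex_cone hull G)"
  shows "convex_cone hull G = (\<Union>B\<in>regular_bases w G. half_open_cone B (visible q B))"
    and "interior (convex_cone hull G) = (\<Union>B\<in>regular_bases w G. half_open_cone B (B - visible q B))"
proof -
  let ?K = "convex_cone hull G"
  have K: "convex_cone ?K" "closed ?K" "q \<in> ?K"
    using closed_convex_cone_hull[OF G(1)] q(2) interior_subset convex_cone_convex_cone_hull by blast+
  have union: "{x. eventually (\<lambda>\<epsilon>. x + \<epsilon> *\<^sub>R p \<in> ?K) (at_right 0)} =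
      (\<Union>B\<in>regular_bases w G. half_open_cone B (visible p B))" if "generic G p" for p
  proof (rule set_eqI)
    fix x
    have "eventually (\<lambda>\<epsilon>. x + \<epsilon> *\<^sub>R p \<in> ?K) (at_right 0) \<longleftrightarrow>
        (\<exists>B\<in>regular_bases w G. x \<in> half_open_cone B (visible p B))"
      by (rule eventually_iff_const[OF eventually_cone_iff_half_open[OF G w that] trivial_limit_at_right_real, symmetric])
    thus "x \<in> {x. eventually (\<lambda>\<epsilon>. x + \<epsilon> *\<^sub>R p \<in> ?K) (at_right 0)} \<longleftrightarrow>
        x \<in> (\<Union>B\<in>regular_bases w G. half_open_cone B (visible p B))"
      by simp
  qed
  have "?K = {x. eventually (\<lambda>\<epsilon>. x + \<epsilon> *\<^sub>R q \<in> ?K) (at_right 0)}"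
    by (intro set_eqI) (simp only: mem_Collect_eq mem_convex_cone_iff_perturbed[OF K, symmetric])
  with union[OF q(1)] show "?K = (\<Union>B\<in>regular_bases w G. half_open_cone B (visible q B))"
    by (rule trans[rotated])
  have "interior ?K = {x. eventually (\<lambda>\<epsilon>. x + \<epsilon> *\<^sub>R (- q) \<in> ?K) (at_right 0)}"
    by (intro set_eqI) (simp only: mem_Collect_eq mem_interior_convex_cone_iff_perturbed[OF K(1) q(2), symmetric])
  also have "\<dots> = (\<Union>B\<in>regular_bases w G. half_open_cone B (visible (- q) B))"
    by (rule union[OF generic_minus[OF q(1)]])
  also have "\<dots> = (\<Union>B\<in>regular_bases w G. half_open_cone B (B - visible q B))"
    by (intro SUP_cong refl arg_cong2[where f = half_open_cone] visible_minus[OF q(1)])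
       (auto simp: regular_bases_def)
  finally show "interior ?K = (\<Union>B\<in>regular_bases w G. half_open_cone B (B - visible q B))" .
qed

section \<open>Lattice points in half-open simplicial cones\<close>

definition level_series :: "('a \<Rightarrow> real) \<Rightarrow> 'a set \<Rightarrow> int fps" where
  "level_series ht A = Abs_fps (\<lambda>k. int (card {x\<in>A. ht x = real k}))"

lemma level_series_nth: "fps_nth (level_series ht A) k = int (card {x\<in>A. ht x = real k})"
  by (simp add: level_series_def)

lemma level_series_UN:
  assumes "finite T" "\<And>B k. B \<in> T \<Longrightarrow> finite {x\<in>A B. ht x = real k}"
    and "\<And>B C. B \<in> T \<Longrightarrow> C \<in> T \<Longrightarrow> B \<noteq> C \<Longrightarrow> A B \<inter> A C = {}"
  shows "level_series ht (\<Union>B\<in>T. A B) = (\<Sum>B\<in>T. level_series ht (A B))"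
proof (rule fps_ext)
  fix k
  have "{x\<in>\<Union>B\<in>T. A B. ht x = real k} = (\<Union>B\<in>T. {x\<in>A B. ht x = real k})"
    by auto
  also have "card \<dots> = (\<Sum>B\<in>T. card {x\<in>A B. ht x = real k})"
    using assms by (intro card_UN_disjoint) blast+
  finally show "fps_nth (level_series ht (\<Union>B\<in>T. A B)) k = fps_nth (\<Sum>B\<in>T. level_series ht (A B)) k"
    by (simp add: level_series_nth fps_sum_nth)
qed

text \<open>Height by height, translation by \<open>b\<close> shifts the series by \<open>m\<close>.\<close>

lemma level_series_remove_translate:
  fixes ht :: "'a::real_vector \<Rightarrow> real"
  assumes "linear ht" "ht b = real m" "\<And>x. x \<in> A \<Longrightarrow> 0 \<le> ht x"
    and "\<And>k. finite {x\<in>A. ht x = real k}"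
    and "(\<lambda>x. b + x) ` A \<subseteq> A"
  shows "level_series ht (A - (\<lambda>x. b + x) ` A) = (1 - fps_X ^ m) * level_series ht A"
proof (rule fps_ext)
  fix k
  let ?L = "\<lambda>S k. {x\<in>S. ht x = real k}"
  have ht: "ht (b + x) = real m + ht x" for x
    using assms(2) by (simp add: linear_add[OF assms(1)])
  have trans: "card (?L ((\<lambda>x. b + x) ` A) k) = (if k < m then 0 else card (?L A (k - m)))"
  proof (cases "k < m")
    case True
    hence "?L ((\<lambda>x. b + x) ` A) k = {}"
      using assms(3) by (force simp: ht)
    thus ?thesis
      using True by (simp only: if_True card.empty)
  next
    case False
    hence "?L ((\<lambda>x. b + x) ` A) k = (\<lambda>x. b + x) ` ?L A (k - m)"
      by (auto simp: ht of_nat_diff)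
    thus ?thesis
      using False by (simp add: card_image)
  qed
  have "?L (A - (\<lambda>x. b + x) ` A) k = ?L A k - ?L ((\<lambda>x. b + x) ` A) k"
    by auto
  moreover have "?L ((\<lambda>x. b + x) ` A) k \<subseteq> ?L A k"
    using assms(5) by auto
  ultimately have "int (card (?L (A - (\<lambda>x. b + x) ` A) k)) =
      int (card (?L A k)) - int (card (?L ((\<lambda>x. b + x) ` A) k))"
    using assms(4)[of k] by (simp add: card_Diff_subset finite_subset card_mono of_nat_diff)
  thus "fps_nth (level_series ht (A - (\<lambda>x. b + x) ` A)) k =
      fps_nth ((1 - fps_X ^ m) * level_series ht A) k"
    by (simp add: trans level_series_nth left_diff_distrib fps_X_power_mult_nth)
qed

lemma ray_nonneg: "a \<in> ray N b \<Longrightarrow> 0 \<le> a"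
  by (auto simp: ray_def split: if_splits)

lemma poly_of_bounded_series:
  fixes f :: "'b::comm_semiring_1 fps"
  assumes "\<And>k. k > n \<Longrightarrow> fps_nth f k = 0"
  obtains p where "fps_of_poly p = f" "degree p \<le> n" "\<And>k. coeff p k = fps_nth f k"
proof
  have "coeff (Abs_poly (\<lambda>k. fps_nth f k)) k = fps_nth f k" for k
    by (subst coeff_Abs_poly[of n]) (use assms in auto)
  thus "\<And>k. coeff (Abs_poly (\<lambda>k. fps_nth f k)) k = fps_nth f k"
    "fps_of_poly (Abs_poly (\<lambda>k. fps_nth f k)) = f" "degree (Abs_poly (\<lambda>k. fps_nth f k)) \<le> n"
    using assms by (auto simp: fps_eq_iff intro!: degree_le)
qed

text \<open>A discrete lattice with a height function, and finitely many lattice vectors of common height \<open>m\<close>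
  which generate the cone under consideration.\<close>

locale graded_lattice_cone =
  fixes L G :: "'a::euclidean_space set" and ht :: "'a \<Rightarrow> real" and m :: nat
  assumes L_add: "x \<in> L \<Longrightarrow> y \<in> L \<Longrightarrow> x + y \<in> L"
    and L_diff: "x \<in> L \<Longrightarrow> y \<in> L \<Longrightarrow> x - y \<in> L"
    and L_zero: "0 \<in> L"
    and L_discrete: "bounded S \<Longrightarrow> finite (L \<inter> S)"
    and ht_linear: "linear ht"
    and m_pos: "m > 0"
    and G_finite: "finite G"
    and G_lattice: "G \<subseteq> L"
    and ht_G: "g \<in> G \<Longrightarrow> ht g = real m"
begin

text \<open>These sets interpolate between the fundamental box (\<open>J = {}\<close>) and the half-open cone (\<open>J = B\<close>): the
  coordinates are bounded above except in the directions in \<open>J\<close>. The bound is phrased as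
  \<open>coord B b x - 1 \<notin> ray N b\<close> so that a half-open unit interval is what remains of a ray
  after removing its translate by \<open>1\<close>: the interval is \<open>{0<..1}\<close> for \<open>b \<in> N\<close> and \<open>{0..<1}\<close> otherwise.\<close>

definition prism :: "'a set \<Rightarrow> 'a set \<Rightarrow> 'a set \<Rightarrow> 'a set" where
  "prism B N J = {x\<in>L. \<forall>b\<in>B. coord B b x \<in> ray N b \<and> (b \<notin> J \<longrightarrow> coord B b x - 1 \<notin> ray N b)}"

lemma ht_coord:
  assumes "is_basis B" "B \<subseteq> G"
  shows "ht x = real m * (\<Sum>b\<in>B. coord B b x)"
proof -
  have "ht x = (\<Sum>b\<in>B. coord B b x * ht b)"
    using linear_sum[OF ht_linear, of "\<lambda>b. coord B b x *\<^sub>R b" B] sum_coord[OF assms(1), of x]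
    by (simp add: linear_scale[OF ht_linear])
  also have "\<dots> = (\<Sum>b\<in>B. coord B b x * real m)"
    using assms(2) by (intro sum.cong) (auto simp: ht_G)
  finally show ?thesis
    by (simp add: sum_distrib_left mult.commute)
qed

lemma prism_ht_nonneg:
  assumes "is_basis B" "B \<subseteq> G" "x \<in> prism B N J"
  shows "0 \<le> ht x"
  unfolding ht_coord[OF assms(1,2)]
  using assms(3) by (intro mult_nonneg_nonneg sum_nonneg) (auto simp: prism_def dest: ray_nonneg)

lemma finite_prism_level:
  assumes "is_basis B" "B \<subseteq> G"
  shows "finite {x\<in>prism B N J. ht x = c}"
proof -
  have "norm x \<le> (\<Sum>b\<in>B. \<bar>c\<bar> / real m * norm b)" if x: "x \<in> prism B N J" "ht x = c" for x
  proof -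
    have nn: "0 \<le> coord B b x" if "b \<in> B" for b
      using x(1) that by (auto simp: prism_def dest: ray_nonneg)
    have "coord B b x \<le> \<bar>c\<bar> / real m" if "b \<in> B" for b
    proof -
      have "coord B b x \<le> (\<Sum>b\<in>B. coord B b x)"
        using nn that is_basis_finite[OF assms(1)] by (intro member_le_sum) auto
      also have "\<dots> = c / real m"
        using ht_coord[OF assms, of x] x(2) m_pos by (simp add: field_simps)
      also have "\<dots> \<le> \<bar>c\<bar> / real m"
        by (intro divide_right_mono) auto
      finally show ?thesis .
    qed
    hence "(\<Sum>b\<in>B. norm (coord B b x *\<^sub>R b)) \<le> (\<Sum>b\<in>B. \<bar>c\<bar> / real m * norm b)"
      using nn by (intro sum_mono) (auto intro: mult_right_mono simp del: times_divide_eq_left)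
    thus ?thesis
      using norm_sum[of "\<lambda>b. coord B b x *\<^sub>R b" B] sum_coord[OF assms(1), of x] by simp
  qed
  hence "bounded {x\<in>prism B N J. ht x = c}"
    by (auto simp: bounded_iff)
  hence "finite (L \<inter> {x\<in>prism B N J. ht x = c})"
    by (rule L_discrete)
  moreover have "L \<inter> {x\<in>prism B N J. ht x = c} = {x\<in>prism B N J. ht x = c}"
    by (auto simp: prism_def)
  ultimately show ?thesis
    by simp
qed

lemma prism_full: "prism B N B = L \<inter> half_open_cone B N"
  by (auto simp: prism_def half_open_cone_def)

lemma prism_step:
  assumes B: "is_basis B" "B \<subseteq> G" and j: "j \<in> B" "j \<notin> J"
  shows "prism B N (insert j J) - (\<lambda>x. j + x) ` prism B N (insert j J) = prism B N J"
proof -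
  have jL: "j \<in> L"
    using B(2) G_lattice j(1) by blast
  have "x \<in> (\<lambda>x. j + x) ` prism B N (insert j J) \<longleftrightarrow> coord B j x - 1 \<in> ray N j"
    if x: "x \<in> prism B N (insert j J)" for x
  proof -
    have "x \<in> (\<lambda>x. j + x) ` prism B N (insert j J) \<longleftrightarrow> x - j \<in> prism B N (insert j J)"
      by (metis (no_types, lifting) add.commute add_diff_cancel_right' diff_add_cancel image_iff)
    also have "\<dots> \<longleftrightarrow> coord B j x - 1 \<in> ray N j"
      using x j(1) L_diff[OF _ jL]
      by (auto simp: prism_def coord_diff[OF B(1)] coord_basis[OF B(1) j(1)])
    finally show ?thesis .
  qed
  thus ?thesis
    using j by (auto simp: prism_def)
qed

lemma prism_translate:
  assumes B: "is_basis B" "B \<subseteq> G" and j: "j \<in> B" "j \<in> J"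
  shows "(\<lambda>x. j + x) ` prism B N J \<subseteq> prism B N J"
proof (rule image_subsetI)
  fix x assume "x \<in> prism B N J"
  moreover have "a + 1 \<in> ray N j" if "a \<in> ray N j" for a
    using that by (auto simp: ray_def split: if_splits)
  ultimately show "j + x \<in> prism B N J"
    using j B(2) G_lattice L_add
    by (auto simp: prism_def coord_add[OF B(1)] coord_basis[OF B(1) j(1)] add.commute[of 1])
qed

text \<open>Removing from a prism its translate by \<open>j\<close> bounds the coordinate of \<open>j\<close>, at the price of a factor
  \<open>1 - s\<^sup>m\<close>. For \<open>J = B\<close> this expresses the series of the half-open cone by the box.\<close>

lemma level_series_prism:
  assumes B: "is_basis B" "B \<subseteq> G" and J: "J \<subseteq> B"
  shows "level_series ht (prism B N {}) = (1 - fps_X ^ m) ^ card J * level_series ht (prism B N J)"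
proof -
  have "finite J"
    using J is_basis_finite[OF B(1)] finite_subset by blast
  thus ?thesis
    using J
  proof (induction J rule: finite_induct)
    case empty
    thus ?case by simp
  next
    case (insert j J)
    have j: "j \<in> B" "j \<in> insert j J"
      using insert.prems by auto
    have "level_series ht (prism B N J) = (1 - fps_X ^ m) * level_series ht (prism B N (insert j J))"
      unfolding prism_step[OF B j(1) insert.hyps(2), symmetric]
      by (rule level_series_remove_translate[OF ht_linear _ prism_ht_nonneg[OF B] finite_prism_level[OF B]
            prism_translate[OF B j]])
         (use j B ht_G in auto)
    thus ?case
      using insert by (simp add: mult.assoc)
  qed
qed

text \<open>The reflection \<open>a \<mapsto> 1 - a\<close> of coordinates exchanges the half-open unit intervals \<open>{0<..1}\<close> and \<open>{0..<1}\<close>.\<close>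

lemma prism_reflect:
  assumes B: "is_basis B" "B \<subseteq> G"
  shows "\<Sum>B - x \<in> prism B (B - N) {} \<longleftrightarrow> x \<in> prism B N {}"
proof -
  have "\<Sum>B \<in> L"
    using is_basis_finite[OF B(1)] B(2) G_lattice
    by (induction B rule: finite_induct) (auto intro: L_add L_zero)
  hence "\<Sum>B - x \<in> L \<longleftrightarrow> x \<in> L"
    using L_diff[of "\<Sum>B" x] L_diff[of "\<Sum>B" "\<Sum>B - x"] by auto
  moreover have "coord B b (\<Sum>B - x) = 1 - coord B b x" if "b \<in> B" for b
    using coord_combination[OF B(1) that, of "\<lambda>_. 1"] by (simp add: coord_diff[OF B(1)])
  ultimately show ?thesis
    unfolding prism_def ray_def by (auto split: if_splits)
qed

lemma box_ht_le:
  assumes B: "is_basis B" "B \<subseteq> G" and x: "x \<in> prism B N {}"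
  shows "ht x \<le> real (m * DIM('a))"
proof -
  have "(\<Sum>b\<in>B. coord B b x) \<le> (\<Sum>b\<in>B. 1)"
    using x by (intro sum_mono) (auto simp: prism_def ray_def split: if_splits)
  hence "real m * (\<Sum>b\<in>B. coord B b x) \<le> real m * real DIM('a)"
    using is_basis_card[OF B(1)] by (intro mult_left_mono) auto
  thus ?thesis
    by (simp add: ht_coord[OF B])
qed

lemma box_series_eq_0:
  assumes B: "is_basis B" "B \<subseteq> G" and k: "k > m * DIM('a)"
  shows "fps_nth (level_series ht (prism B N {})) k = 0"
proof -
  have "{x\<in>prism B N {}. ht x = real k} = {}"
  proof safe
    fix x assume "x \<in> prism B N {}" "ht x = real k"
    hence "k \<le> m * DIM('a)"
      using box_ht_le[OF B, of x N] by (simp only: of_nat_le_iff)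
    thus "x \<in> {}"
      using k by simp
  qed
  thus ?thesis
    by (simp add: level_series_nth del: Collect_empty_eq)
qed

lemma box_series_reflect:
  assumes B: "is_basis B" "B \<subseteq> G" and k: "k \<le> m * DIM('a)"
  shows "fps_nth (level_series ht (prism B (B - N) {})) k =
         fps_nth (level_series ht (prism B N {})) (m * DIM('a) - k)"
proof -
  have "ht (\<Sum>B) = (\<Sum>b\<in>B. ht b)"
    by (rule linear_sum[OF ht_linear])
  also have "\<dots> = (\<Sum>b\<in>B. real m)"
    using B(2) by (intro sum.cong) (auto simp: ht_G)
  finally have "ht (\<Sum>B) = real (m * DIM('a))"
    by (simp add: is_basis_card[OF B(1)])
  hence ht: "ht (\<Sum>B - x) = real (m * DIM('a)) - ht x" for x
    by (simp add: linear_diff[OF ht_linear])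
  have "bij_betw (\<lambda>x. \<Sum>B - x) {x\<in>prism B N {}. ht x = real (m * DIM('a) - k)}
      {x\<in>prism B (B - N) {}. ht x = real k}"
  proof (rule bij_betw_byWitness[where f' = "\<lambda>x. \<Sum>B - x"])
    show "(\<lambda>x. \<Sum>B - x) ` {x\<in>prism B (B - N) {}. ht x = real k}
        \<subseteq> {x\<in>prism B N {}. ht x = real (m * DIM('a) - k)}"
    proof (rule image_subsetI)
      fix x assume x: "x \<in> {x\<in>prism B (B - N) {}. ht x = real k}"
      have "\<Sum>B - x \<in> prism B N {}"
        using x prism_reflect[OF B, of "\<Sum>B - x" N] by simp
      thus "\<Sum>B - x \<in> {x\<in>prism B N {}. ht x = real (m * DIM('a) - k)}"
        using x k unfolding mem_Collect_eq ht by (simp add: of_nat_diff del: of_nat_mult)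
    qed
    show "(\<lambda>x. \<Sum>B - x) ` {x\<in>prism B N {}. ht x = real (m * DIM('a) - k)}
        \<subseteq> {x\<in>prism B (B - N) {}. ht x = real k}"
      using k prism_reflect[OF B] by (auto simp: ht of_nat_diff simp del: of_nat_mult)
  qed auto
  thus ?thesis
    by (simp add: level_series_nth bij_betw_same_card)
qed

text \<open>Summation over the pieces: both polynomials are sums of box polynomials, taken for complementary sets of
  excluded facets, and the coefficient reversal holds for each box.\<close>

theorem cone_series_reciprocity:
  assumes interior: "interior (convex_cone hull G) \<noteq> {}"
  obtains h h' where
    "fps_of_poly h = (1 - fps_X ^ m) ^ DIM('a) * level_series ht (L \<inter> convex_cone hull G)"
    "fps_of_poly h' = (1 - fps_X ^ m) ^ DIM('a) * level_series ht (L \<inter> interior (convex_cone hull G))"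
    "degree h \<le> m * DIM('a)" "degree h' \<le> m * DIM('a)"
    "\<And>k. k \<le> m * DIM('a) \<Longrightarrow> coeff h' k = coeff h (m * DIM('a) - k)"
proof -
  let ?n = "m * DIM('a)" and ?K = "convex_cone hull G"
  obtain w where w: "generic_weights G w"
    using exists_generic_weights[OF G_finite] by blast
  obtain q where q: "generic G q" "q \<in> interior ?K"
    using exists_generic[OF G_finite open_interior interior] by blast
  define T where "T = regular_bases w G"
  have T: "is_basis B" "B \<subseteq> G" if "B \<in> T" for B
    using that by (auto simp: T_def regular_bases_def)
  have finT: "finite T"
    by (rule finite_subset[of _ "Pow G"]) (use T G_finite in auto)
  \<comment> \<open>The triangulation lemmas are stated for generators of height 1.\<close>
  define ht1 where "ht1 = (\<lambda>x. ht x / real m)"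
  have ht1: "linear ht1" "\<And>g. g \<in> G \<Longrightarrow> ht1 g = 1"
    using m_pos ht_G ht_linear by (auto simp: ht1_def linear_iff add_divide_distrib)
  have decomp: "?K = (\<Union>B\<in>T. half_open_cone B (visible q B))"
    "interior ?K = (\<Union>B\<in>T. half_open_cone B (B - visible q B))"
    using cone_half_open_decomposition[OF G_finite ht1 w q] by (simp_all only: T_def)
  have series: "(1 - fps_X ^ m) ^ DIM('a) * level_series ht (L \<inter> (\<Union>B\<in>T. half_open_cone B (N B))) =
      (\<Sum>B\<in>T. level_series ht (prism B (N B) {}))"
    if disj: "\<And>B C. B \<in> T \<Longrightarrow> C \<in> T \<Longrightarrow> B \<noteq> C \<Longrightarrow> half_open_cone B (N B) \<inter> half_open_cone C (N C) = {}" for N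
  proof -
    have "L \<inter> (\<Union>B\<in>T. half_open_cone B (N B)) = (\<Union>B\<in>T. prism B (N B) B)"
      by (auto simp: prism_full)
    moreover have "level_series ht (\<Union>B\<in>T. prism B (N B) B) = (\<Sum>B\<in>T. level_series ht (prism B (N B) B))"
      using disj by (intro level_series_UN finT finite_prism_level T) (auto simp: prism_full)
    moreover have "level_series ht (prism B (N B) {}) = (1 - fps_X ^ m) ^ DIM('a) * level_series ht (prism B (N B) B)"
      if "B \<in> T" for B
      using level_series_prism[OF T[OF that] order_refl, of "N B"] is_basis_card[OF T(1)[OF that]] by simp
    ultimately show ?thesis
      by (simp add: sum_distrib_left)
  qed
  have disj: "half_open_cone B (visible p B) \<inter> half_open_cone C (visible p C) = {}"
    if "generic G p" "B \<in> T" "C \<in> T" "B \<noteq> C" for p B C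
    using half_open_cones_disjoint[OF G_finite that(1), of B w C] that(2-4) by (auto simp: T_def)
  have vis: "B - visible q B = visible (- q) B" if "B \<in> T" for B
    using visible_minus[OF q(1) T[OF that]] by simp
  define H where "H = (\<Sum>B\<in>T. level_series ht (prism B (visible q B) {}))"
  define H' where "H' = (\<Sum>B\<in>T. level_series ht (prism B (B - visible q B) {}))"
  have H: "H = (1 - fps_X ^ m) ^ DIM('a) * level_series ht (L \<inter> ?K)"
    unfolding H_def decomp(1) by (rule series[symmetric]) (rule disj[OF q(1)])
  have H': "H' = (1 - fps_X ^ m) ^ DIM('a) * level_series ht (L \<inter> interior ?K)"
    unfolding H'_def decomp(2) by (rule series[symmetric]) (simp add: vis disj[OF generic_minus[OF q(1)]])
  have zero: "fps_nth H k = 0" "fps_nth H' k = 0" if "k > ?n" for k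
    using that T by (auto simp: H_def H'_def fps_sum_nth box_series_eq_0)
  obtain h where h: "fps_of_poly h = H" "degree h \<le> ?n" "\<And>k. coeff h k = fps_nth H k"
    using poly_of_bounded_series[of ?n H] zero by blast
  obtain h' where h': "fps_of_poly h' = H'" "degree h' \<le> ?n" "\<And>k. coeff h' k = fps_nth H' k"
    using poly_of_bounded_series[of ?n H'] zero by blast
  have "coeff h' k = coeff h (?n - k)" if "k \<le> ?n" for k
    unfolding h(3) h'(3) H_def H'_def fps_sum_nth
    by (intro sum.cong refl box_series_reflect T that)
  with h h' H H' that show ?thesis
    by metis
qed

end

section \<open>The cone over a polytope\<close>

lemma interior_scaleR_image:
  fixes S :: "'a::euclidean_space set"
  assumes "c \<noteq> 0"
  shows "interior ((\<lambda>x. c *\<^sub>R x) ` S) = (\<lambda>x. c *\<^sub>R x) ` interior S"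
  using assms by (intro interior_injective_linear_image) (auto simp: linear_scaleR inj_on_def)

text \<open>The generators \<open>W \<times> {m}\<close> lie at height \<open>m\<close>, so the slice at height \<open>t\<close> is the polytope dilated by \<open>t / m\<close>;
  the only point of the cone of height at most \<open>0\<close> is the apex.\<close>

lemma mem_cone_over_iff:
  fixes W :: "'a::euclidean_space set"
  assumes "m > 0"
  shows "(x, t) \<in> convex_cone hull (W \<times> {m}) \<longleftrightarrow>
    (if t > 0 then x \<in> (\<lambda>y. (t / m) *\<^sub>R y) ` (convex hull W) else x = 0 \<and> t = 0)"
proof -
  have "(x, t) \<in> convex_cone hull (W \<times> {m}) \<longleftrightarrow>
      (x = 0 \<and> t = 0) \<or> (\<exists>y\<in>convex hull W. \<exists>c\<ge>0. x = c *\<^sub>R y \<and> t = c * m)"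
    unfolding convex_cone_hull_convex_hull convex_hull_Times by (auto simp: zero_prod_def)
  also have "\<dots> \<longleftrightarrow> (if t > 0 then x \<in> (\<lambda>y. (t / m) *\<^sub>R y) ` (convex hull W) else x = 0 \<and> t = 0)"
  proof (cases "t > 0")
    case True
    hence "(\<exists>c\<ge>0. x = c *\<^sub>R y \<and> t = c * m) \<longleftrightarrow> x = (t / m) *\<^sub>R y" for y
      using assms by (auto intro!: exI[of _ "t / m"])
    thus ?thesis
      using True by auto
  next
    case False
    have "c = 0" if "c \<ge> 0" "t = c * m" for c
      using False that assms by (simp add: zero_less_mult_iff)
    thus ?thesis
      using False by auto
  qed
  finally show ?thesis .
qed

text \<open>An interior point of the cone has positive height, since one can decrease its height a little
  within the cone, and it is interior in its slice. Conversely, \<open>(y, t) \<mapsto> (m / t) y\<close> is continuous for positive \<open>t\<close>, so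
  the preimage of the interior of the polytope is an open subset of the cone.\<close>

lemma mem_interior_cone_over_iff:
  fixes W :: "'a::euclidean_space set"
  assumes m: "m > 0"
  shows "(x, t) \<in> interior (convex_cone hull (W \<times> {m})) \<longleftrightarrow>
    t > 0 \<and> x \<in> (\<lambda>y. (t / m) *\<^sub>R y) ` interior (convex hull W)"
proof
  let ?K = "convex_cone hull (W \<times> {m})"
  assume int: "(x, t) \<in> interior ?K"
  have cont: "((\<lambda>\<epsilon>. (x, t - \<epsilon>)) \<longlongrightarrow> (x, t - 0)) (at_right 0)"
    by (intro tendsto_intros)
  hence "eventually (\<lambda>\<epsilon>. (x, t - \<epsilon>) \<in> interior ?K) (at_right 0)"
    by (rule topological_tendstoD) (use int in auto)
  with eventually_at_right_less[of "0::real"]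
  have "eventually (\<lambda>\<epsilon>. 0 < \<epsilon> \<and> (x, t - \<epsilon>) \<in> ?K) (at_right 0)"
    by eventually_elim (use interior_subset in auto)
  then obtain \<epsilon> :: real where "\<epsilon> > 0" "(x, t - \<epsilon>) \<in> ?K"
    using eventually_happens[of _ "at_right (0::real)"] by auto
  hence t: "t > 0"
    using mem_cone_over_iff[OF m, of x "t - \<epsilon>" W] by (auto split: if_splits)
  have "open ((\<lambda>y. (y, t)) -` interior ?K)"
    by (intro open_vimage continuous_intros) auto
  moreover have "(\<lambda>y. (y, t)) -` interior ?K \<subseteq> (\<lambda>y. (t / m) *\<^sub>R y) ` (convex hull W)"
    using mem_cone_over_iff[OF m, of _ t W] t interior_subset[of ?K] by auto
  ultimately have "x \<in> interior ((\<lambda>y. (t / m) *\<^sub>R y) ` (convex hull W))"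
    using int by (intro interiorI[of "(\<lambda>y. (y, t)) -` interior ?K"]) auto
  thus "t > 0 \<and> x \<in> (\<lambda>y. (t / m) *\<^sub>R y) ` interior (convex hull W)"
    using t m by (simp add: interior_scaleR_image)
next
  let ?K = "convex_cone hull (W \<times> {m})"
  assume R: "t > 0 \<and> x \<in> (\<lambda>y. (t / m) *\<^sub>R y) ` interior (convex hull W)"
  \<comment> \<open>The open half-space on which projecting a point along its ray to height \<open>m\<close> is continuous.\<close>
  define U where "U = {z :: 'a \<times> real. 0 < snd z}"
  have "open U"
    unfolding U_def by (intro open_Collect_less continuous_intros)
  moreover have "continuous_on U (\<lambda>z. (m / snd z) *\<^sub>R fst z)"
    by (intro continuous_intros) (auto simp: U_def)
  ultimately have "open ((\<lambda>z. (m / snd z) *\<^sub>R fst z) -` interior (convex hull W) \<inter> U)"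
    using continuous_on_open_vimage[of U "\<lambda>z. (m / snd z) *\<^sub>R fst z"] by blast
  moreover have "(\<lambda>z. (m / snd z) *\<^sub>R fst z) -` interior (convex hull W) \<inter> U \<subseteq> ?K"
  proof (rule subsetI)
    fix z assume z: "z \<in> (\<lambda>z. (m / snd z) *\<^sub>R fst z) -` interior (convex hull W) \<inter> U"
    hence "fst z \<in> (\<lambda>y. (snd z / m) *\<^sub>R y) ` (convex hull W)"
      using m interior_subset[of "convex hull W"]
      by (intro image_eqI[of _ _ "(m / snd z) *\<^sub>R fst z"]) (auto simp: U_def)
    hence "(fst z, snd z) \<in> ?K"
      using z by (subst mem_cone_over_iff[OF m]) (simp add: U_def)
    thus "z \<in> ?K"
      by simp
  qed
  ultimately show "(x, t) \<in> interior ?K"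
    using R m by (intro interiorI) (auto simp: U_def)
qed

definition int_points :: "(real^'n) set" where
  "int_points = {x. \<forall>i. x $ i \<in> \<int>}"

lemma finite_bounded_int_points:
  assumes "bounded (S :: (real^'n) set)"
  shows "finite (int_points \<inter> S)"
proof -
  obtain R where R: "\<And>x. x \<in> S \<Longrightarrow> norm x \<le> R"
    using assms by (auto simp: bounded_iff)
  have "int_points \<inter> S \<subseteq> (\<lambda>f. \<chi> i. f i) ` (UNIV \<rightarrow>\<^sub>E {a. a \<in> \<int> \<and> \<bar>a\<bar> \<le> R})"
  proof
    fix x assume x: "x \<in> int_points \<inter> S"
    have "\<bar>x $ i\<bar> \<le> R" for i
      using component_le_norm_cart[of x i] R[of x] x by auto
    thus "x \<in> (\<lambda>f. \<chi> i. f i) ` (UNIV \<rightarrow>\<^sub>E {a. a \<in> \<int> \<and> \<bar>a\<bar> \<le> R})"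
      using x by (intro image_eqI[of _ _ "\<lambda>i. x $ i"]) (auto simp: int_points_def)
  qed
  moreover have "finite {a::real. a \<in> \<int> \<and> \<bar>a\<bar> \<le> R}"
    by (rule finite_abs_int_segment)
  ultimately show ?thesis
    by (meson finite_PiE finite finite_imageI finite_subset)
qed

lemma graded_lattice_cone_over:
  fixes W :: "(real^'n) set"
  assumes "finite W" "W \<subseteq> int_points" "m > 0"
  shows "graded_lattice_cone (int_points \<times> \<int>) (W \<times> {real m}) snd m"
proof
  fix S :: "((real^'n) \<times> real) set" assume "bounded S"
  hence "bounded (fst ` S)" "bounded (snd ` S)"
    by (auto intro: bounded_fst bounded_snd)
  moreover from this(2) obtain R where R: "\<And>t. t \<in> snd ` S \<Longrightarrow> \<bar>t\<bar> \<le> R"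
    by (auto simp: bounded_iff)
  ultimately have "finite ((int_points \<inter> fst ` S) \<times> {a::real. a \<in> \<int> \<and> \<bar>a\<bar> \<le> R})"
    by (intro finite_cartesian_product finite_bounded_int_points finite_abs_int_segment)
  moreover have "(int_points \<times> \<int>) \<inter> S \<subseteq> (int_points \<inter> fst ` S) \<times> {a::real. a \<in> \<int> \<and> \<bar>a\<bar> \<le> R}"
    using R by force
  ultimately show "finite ((int_points \<times> \<int>) \<inter> S)"
    by (rule finite_subset[rotated])
qed (use assms in \<open>auto simp: int_points_def zero_prod_def linear_snd\<close>)

lemma codenominator_pos:
  assumes "has_codenominator P r"
  shows "r > 0"
proof -
  obtain H where "irredundant_description P H" "int r = Lcm (snd ` H - {0})"
    using assms by (auto simp: has_codenominator_def)
  moreover from this have "finite (snd ` H - {0})"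
    by (auto simp: irredundant_description_def)
  ultimately have "int r \<noteq> 0"
    by (auto simp: Lcm_0_iff)
  thus ?thesis
    by simp
qed

lemma full_dimensional_interior:
  fixes P :: "(real^'n) set"
  assumes "convex P" "full_dimensional P"
  shows "interior P \<noteq> {}"
proof -
  have "affine hull P = UNIV"
    using assms(2) by (simp add: full_dimensional_def flip: aff_dim_eq_full)
  moreover have "P \<noteq> {}"
    using assms(2) by (auto simp: full_dimensional_def)
  ultimately show ?thesis
    using rel_interior_interior[of P] rel_interior_eq_empty[OF assms(1)] by simp
qed

lemma level_series_slice:
  "fps_nth (level_series snd ((int_points \<times> \<int>) \<inter> S)) k = int (card {x \<in> int_points. (x, real k) \<in> S})"
proof -
  have "bij_betw fst {p \<in> (int_points \<times> \<int>) \<inter> S. snd p = real k} {x \<in> int_points. (x, real k) \<in> S}"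
    by (rule bij_betw_byWitness[where f' = "\<lambda>x. (x, real k)"]) auto
  thus ?thesis
    unfolding level_series_nth by (simp only: bij_betw_same_card)
qed

text \<open>The dilation factor \<open>k / m\<close> of the slice at height \<open>k\<close> composed with \<open>m / r\<close> is \<open>k / r\<close>. Stated for
  arbitrary sets so as to apply to the polytope as well as to its interior.\<close>

lemma ehr_Q_eq_card_level:
  fixes S T :: "(real^'n) set"
  assumes "r > 0" "m > 0" "k > 0" and S: "T = (\<lambda>x. (real m / real r) *\<^sub>R x) ` S"
  shows "ehr_Q S (of_nat k / of_nat r) = card (int_points \<inter> (\<lambda>y. (real k / real m) *\<^sub>R y) ` T)"
proof -
  have "(\<lambda>y. (real k / real m) *\<^sub>R y) ` T = (\<lambda>x. of_rat (of_nat k / of_nat r) *\<^sub>R x) ` S"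
    using assms by (simp add: S image_image of_rat_divide)
  thus ?thesis
    by (simp add: ehr_Q_def int_points_def Int_commute)
qed

section \<open>Substituting the inverse of the variable\<close>

lemma eval_poly_eq_sum:
  assumes "degree p \<le> n"
  shows "eval_poly p x = (\<Sum>i\<le>n. of_int (coeff p i) * x ^ i)"
proof -
  have "eval_poly p x = (\<Sum>i\<le>degree p. of_int (coeff p i) * x ^ i)"
    by (simp add: eval_poly_def poly_altdef coeff_map_poly degree_map_poly)
  also have "\<dots> = (\<Sum>i\<le>n. of_int (coeff p i) * x ^ i)"
    using assms by (intro sum.mono_neutral_left) (auto simp: coeff_eq_0)
  finally show ?thesis .
qed

lemma root_t_nonzero: "root_t \<noteq> 0"
  by (simp add: root_t_def)

text \<open>Reversing the coefficients \<open>0, \<dots>, n\<close> of a polynomial means substituting the inverse of the variable and multiplying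
  by the \<open>n\<close>-th power of the variable.\<close>

lemma to_fract_reversed_poly:
  assumes "degree h \<le> n" "degree h' \<le> n" "\<And>k. k \<le> n \<Longrightarrow> coeff h' k = coeff h (n - k)"
  shows "to_fract h' = root_t ^ n * eval_poly h (1 / root_t)"
proof -
  have "to_fract h' = (\<Sum>k\<le>n. of_int (coeff h' k) * root_t ^ k)"
    unfolding eval_poly_root_t[symmetric] by (rule eval_poly_eq_sum[OF assms(2)])
  also have "\<dots> = (\<Sum>k\<le>n. of_int (coeff h k) * root_t ^ (n - k))"
    by (rule sum.reindex_bij_witness[of _ "\<lambda>k. n - k" "\<lambda>k. n - k"]) (auto simp: assms(3))
  also have "\<dots> = (\<Sum>k\<le>n. root_t ^ n * (of_int (coeff h k) * (1 / root_t) ^ k))"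
    by (intro sum.cong) (auto simp: power_diff root_t_nonzero power_divide)
  also have "\<dots> = root_t ^ n * eval_poly h (1 / root_t)"
    by (simp add: eval_poly_eq_sum[OF assms(1)] sum_distrib_left)
  finally show ?thesis .
qed

lemma eval_poly_one_minus_monom_power:
  "eval_poly ((1 - monom 1 m) ^ n) x = (1 - x ^ m) ^ n"
proof (induction n)
  case 0
  show ?case by (simp add: eval_poly_def)
next
  case (Suc n)
  have "map_poly of_int (1 - monom 1 m :: int poly) = (1 - monom 1 m :: ratfun poly)"
    by (rule poly_eqI) (simp add: coeff_map_poly)
  hence "eval_poly (1 - monom 1 m) x = 1 - x ^ m"
    by (simp add: eval_poly_def poly_monom)
  thus ?case
    by (simp add: eval_poly_mult Suc)
qed

text \<open>The sign \<open>(-1)\<^sup>D\<close> comes from the denominator, as \<open>1 - s\<^sup>m = - s\<^sup>m (1 - s\<^sup>-\<^sup>m)\<close>; the power \<open>(s\<^sup>m)\<^sup>D\<close> that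
  appears with it cancels against the one from reversing the numerator.\<close>

lemma ratfun_reciprocity:
  assumes h: "fps_of_poly h = (1 - fps_X ^ m) ^ D * f"
    and h': "fps_of_poly h' = (1 - fps_X ^ m) ^ D * f'"
    and deg: "degree h \<le> m * D" "degree h' \<le> m * D"
    and rev: "\<And>k. k \<le> m * D \<Longrightarrow> coeff h' k = coeff h (m * D - k)"
    and m: "m > 0"
  shows "\<exists>E E'. expansion f E \<and> expansion f' E' \<and> E' = to_fract h' / (1 - root_t ^ m) ^ D \<and>
    E' = (-1) ^ D * subst_ratfun E (1 / root_t) \<and>
    to_fract h' = (root_t ^ m) ^ D * subst_ratfun (to_fract h) (1 / root_t)"
proof -
  define Q :: "int poly" where "Q = (1 - monom 1 m) ^ D"
  have "coeff (1 - monom 1 m :: int poly) 0 = 1"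
    using m by simp
  hence "1 - monom 1 m \<noteq> (0 :: int poly)"
    by force
  hence Q: "Q \<noteq> 0"
    by (simp add: Q_def)
  have fps_Q: "fps_of_poly Q = (1 - fps_X ^ m) ^ D"
    by (simp add: Q_def fps_of_poly_power fps_of_poly_diff fps_of_poly_monom')
  have fract_Q: "to_fract Q = (1 - root_t ^ m) ^ D"
    unfolding eval_poly_root_t[symmetric] Q_def by (rule eval_poly_one_minus_monom_power)
  have exp: "expansion f (to_fract h / to_fract Q)" "expansion f' (to_fract h' / to_fract Q)"
    unfolding expansion_def using Q fps_Q h h' by (metis mult.commute)+
  have subst_h: "subst_ratfun (to_fract h) (1 / root_t) = eval_poly h (1 / root_t)"
    using subst_ratfun_inverse_root_t[of 1 h] by (simp add: eval_poly_def)
  have h'_eq: "to_fract h' = (root_t ^ m) ^ D * eval_poly h (1 / root_t)"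
    using to_fract_reversed_poly[OF deg rev] by (simp add: power_mult)
  have "1 - root_t ^ m = - (root_t ^ m) * (1 - (1 / root_t) ^ m)"
    using root_t_nonzero by (simp add: field_simps)
  hence den: "(1 - root_t ^ m) ^ D = (-1) ^ D * ((root_t ^ m) ^ D * (1 - (1 / root_t) ^ m) ^ D)"
    by (simp only: power_mult_distrib power_minus[of "root_t ^ m"] mult.assoc)
  have "to_fract h' / to_fract Q = (-1) ^ D * (eval_poly h (1 / root_t) / (1 - (1 / root_t) ^ m) ^ D)"
    unfolding fract_Q h'_eq den
    using root_t_nonzero by (cases "even D") (simp_all add: divide_inverse)
  also have "\<dots> = (-1) ^ D * subst_ratfun (to_fract h / to_fract Q) (1 / root_t)"
    unfolding subst_ratfun_inverse_root_t[OF Q] by (simp add: Q_def eval_poly_one_minus_monom_power)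
  finally show ?thesis
    using exp fract_Q h'_eq subst_h by metis
qed

section \<open>Reciprocity\<close>

theorem corollary16:
  fixes P :: "(real^'n) set" and r m :: nat
  assumes "rational_polytope P" and "full_dimensional P"
    and "has_codenominator P r"
    and "m > 0" and "lattice_polytope ((\<lambda>x. (real m / real r) *\<^sub>R x) ` P)"
  shows "\<exists>(h :: int poly) (h_int :: int poly) (E :: ratfun) (E_int :: ratfun).
           fps_of_poly h = hstar_Q r m P \<and>
           expansion (Ehr_Q r P) E \<and>
           expansion (Ehr_Q_interior r P) E_int \<and>
           E_int = to_fract h_int / (1 - root_t ^ m) ^ (CARD('n) + 1) \<and>
           E_int = (-1) ^ (CARD('n) + 1) * subst_ratfun E (1 / root_t) \<and>
           to_fract h_int =
             (root_t ^ m) ^ (CARD('n) + 1) * subst_ratfun (to_fract h) (1 / root_t)"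
proof -
  have r: "r > 0"
    using assms(3) by (rule codenominator_pos)
  have "convex P"
    using assms(1) by (auto simp: rational_polytope_def convex_convex_hull)
  hence int_P: "interior P \<noteq> {}"
    using assms(2) by (rule full_dimensional_interior)
  obtain W :: "(real^'n) set" where "finite W" "\<forall>w\<in>W. \<forall>i. w $ i \<in> \<int>"
    "(\<lambda>x. (real m / real r) *\<^sub>R x) ` P = convex hull W"
    using assms(5) unfolding lattice_polytope_def by blast
  hence W: "finite W" "W \<subseteq> int_points" "convex hull W = (\<lambda>x. (real m / real r) *\<^sub>R x) ` P"
    by (auto simp: int_points_def)
  have int_W: "interior (convex hull W) = (\<lambda>x. (real m / real r) *\<^sub>R x) ` interior P"
    using assms(4) r by (simp add: W(3) interior_scaleR_image)
  define K where "K = convex_cone hull (W \<times> {real m})"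
  define L :: "((real^'n) \<times> real) set" where "L = int_points \<times> \<int>"
  have mem_K: "(x, t) \<in> K \<longleftrightarrow>
      (if t > 0 then x \<in> (\<lambda>y. (t / real m) *\<^sub>R y) ` (convex hull W) else x = 0 \<and> t = 0)" for x t
    unfolding K_def using assms(4) by (intro mem_cone_over_iff) simp
  have mem_int_K: "(x, t) \<in> interior K \<longleftrightarrow>
      t > 0 \<and> x \<in> (\<lambda>y. (t / real m) *\<^sub>R y) ` interior (convex hull W)" for x t
    unfolding K_def using assms(4) by (intro mem_interior_cone_over_iff) simp
  have series: "level_series snd (L \<inter> K) = Ehr_Q r P"
  proof (rule fps_ext)
    fix k
    show "fps_nth (level_series snd (L \<inter> K)) k = fps_nth (Ehr_Q r P) k"
    proof (cases "k = 0")
      case True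
      \<comment> \<open>The constant coefficient 1 of the series counts the apex of the cone.\<close>
      have "{x \<in> int_points. (x, real k) \<in> K} = {0 :: real^'n}"
        by (auto simp: True mem_K int_points_def)
      thus ?thesis
        by (simp add: L_def level_series_slice Ehr_Q_def True)
    next
      case False
      hence "{x \<in> int_points. (x, real k) \<in> K} =
          int_points \<inter> (\<lambda>y. (real k / real m) *\<^sub>R y) ` (convex hull W)"
        by (auto simp: mem_K)
      thus ?thesis
        using False ehr_Q_eq_card_level[OF r assms(4) _ W(3), of k]
        by (simp add: L_def level_series_slice Ehr_Q_def)
    qed
  qed
  have series_int: "level_series snd (L \<inter> interior K) = Ehr_Q_interior r P"
  proof (rule fps_ext)
    fix k
    show "fps_nth (level_series snd (L \<inter> interior K)) k = fps_nth (Ehr_Q_interior r P) k"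
    proof (cases "k = 0")
      case True
      thus ?thesis
        by (simp add: L_def level_series_slice Ehr_Q_interior_def mem_int_K)
    next
      case False
      hence "{x \<in> int_points. (x, real k) \<in> interior K} =
          int_points \<inter> (\<lambda>y. (real k / real m) *\<^sub>R y) ` interior (convex hull W)"
        by (auto simp: mem_int_K)
      thus ?thesis
        using False ehr_Q_eq_card_level[OF r assms(4) _ int_W, of k]
        by (simp add: L_def level_series_slice Ehr_Q_interior_def)
    qed
  qed
  have "interior K \<noteq> {}"
  proof -
    obtain y where "y \<in> interior (convex hull W)"
      using int_P unfolding int_W by blast
    hence "(y, real m) \<in> interior K"
      using assms(4) unfolding mem_int_K by simp
    thus ?thesis
      by blast
  qed
  have cone: "graded_lattice_cone L (W \<times> {real m}) snd m"
    unfolding L_def by (rule graded_lattice_cone_over[OF W(1,2) assms(4)])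
  have dim: "DIM((real^'n) \<times> real) = CARD('n) + 1"
    by simp
  obtain h h' where
    "fps_of_poly h = (1 - fps_X ^ m) ^ (CARD('n) + 1) * Ehr_Q r P"
    "fps_of_poly h' = (1 - fps_X ^ m) ^ (CARD('n) + 1) * Ehr_Q_interior r P"
    "degree h \<le> m * (CARD('n) + 1)" "degree h' \<le> m * (CARD('n) + 1)"
    "\<And>k. k \<le> m * (CARD('n) + 1) \<Longrightarrow> coeff h' k = coeff h (m * (CARD('n) + 1) - k)"
    using graded_lattice_cone.cone_series_reciprocity[OF cone]
    unfolding K_def[symmetric] dim series series_int using \<open>interior K \<noteq> {}\<close> by blast
  from ratfun_reciprocity[OF this assms(4)] this(1) show ?thesis
    unfolding hstar_Q_def by metis
qed

end
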